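(* For any realization $x_1,\dots,x_n$ of $X_1,\dots,X_n$, any integer $m\ge1$ and any $0\le\varepsilon\le1$, $$\mathbb P\Big(\mathbb L\big((\hat g_1^n)_{\hat k}\big)-\hat L_m\big((\hat g_1^n)_{\hat k}\big)>\varepsilon\Big)\le N\Big(2\exp\Big(\frac{\ln 2}{t_{mix}}\Big)+1\Big)\exp\Big(-\frac{m\varepsilon^2\ln 2}{(1+9\ln 2)t_{mix}}\Big)$$ and $$\mathbb P\Big(\hat L_m\big((\hat g_1^n)_{\tilde k}\big)-\mathbb L\big((\hat g_1^n)_{\tilde k}\big)>\varepsilon\Big)\le N\Big(2\exp\Big(\frac{\ln 2}{t_{mix}}\Big)+1\Big)\exp\Big(-\frac{m\varepsilon^2\ln 2}{(1+9\ln 2)t_{mix}}\Big).$$ Moreover, $$\mathbb E\Big(\mathbb L\big((\hat g_1^n)_{\hat k}\big)-\hat L_m\big((\hat g_1^n)_{\hat k}\big)\Big)\le\sqrt{\frac{\ln\big(eN\big(2\exp(\frac{\ln 2}{t_{mix}})+1\big)\big)(1+9\ln 2)\,t_{mix}}{m\ln 2}}$$ and $$\mathbb E\Big(\hat L_m\big((\hat g_1^n)_{\tilde k}\big)-\mathbb L\big((\hat g_1^n)_{\tilde k}\big)\Big)\le\sqrt{\frac{\ln\big(eN\big(2\exp(\frac{\ln 2}{t_{mix}})+1\big)\big)(1+9\ln 2)\,t_{mix}}{m\ln 2}}.$$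
   Context: Process. Let $\mathcal Y$ be a Polish space and $(Y_t)_{t\in\mathbb Z}$ a $\mathcal Y$-valued Markov chain of order $k_0$ that is time homogeneous, stationary and uniformly ergodic. Fix an integer $p\ge k_0$ and put $X_t=(Y_t,Y_{t-1},\dots,Y_{t-p})^T$, with values in $\mathcal X=\mathcal Y^{p+1}$. Then $(X_t)_{t\in\mathbb Z}$ is a time homogeneous, stationary, uniformly ergodic Markov chain of order $1$; $K$ denotes its transition kernel and $Q$ its stationary law. With $d_{TV}(P,P')=\sup_A|P(A)-P'(A)|$, uniform ergodicity means that there are $C>0$ and $0<\rho<1$ with $\sup_{x\in\mathcal X}d_{TV}(K^n(x,\cdot),Q)\le C\rho^n$ for all $n$. The mixing time is $t_{mix}=\min\{t\ge 1:\ \sup_{x\in\mathcal X}d_{TV}(K^t(x,\cdot),Q)\le 1/4\}$. Losses. A prediction function is a measurable $g:\mathcal Y^p\to\mathcal Y$; $\mathcal F$ is the set of all of them. A loss function is a measurable $L:\mathcal Y^2\to[0,1]$; write $L(g(X_t)):=L(g(Y_{t-1},\dots,Y_{t-p}),Y_t)$. The expected loss is $\mathbb L(g)=\mathbb E_Q(L(g(X)))$ with $X\sim Q$. The out-of-sample empirical loss on the validation set $(X_{n+1},\dots,X_{n+m})$ is $\hat L_m(g)=\frac1m\sum_{j=n+1}^{n+m}L(g(X_j))$. Estimators and selection. Let $\tilde L$ be a loss function (possibly different from $L$), $N$ a positive integer and $\mathcal G_1,\dots,\mathcal G_N\subset\mathcal F$. For a realization $x_1,\dots,x_n$ of the learning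 set $X_1,\dots,X_n$, $(\hat g_1^n)_k\in\arg\min_{g\in\mathcal G_k}\sum_{t=1}^n\tilde L(g(x_t))$, $k=1,\dots,N$. Put $\tilde k\in\arg\min_{1\le k\le N}\mathbb L((\hat g_1^n)_k)$ and $\hat k\in\arg\min_{1\le k\le N}\hat L_m((\hat g_1^n)_k)$ ($\hat k$ depends on the validation set and is random). $\mathbb P$ and $\mathbb E$ are taken conditionally on $X_1=x_1,\dots,X_n=x_n$; thus the functions $(\hat g_1^n)_k$ are fixed, and $(X_{n+j})_{j\ge1}$ is the chain with kernel $K$ started from $X_n=x_n$. *)

theory Defs
  imports "HOL-Probability.Probability"
begin

section \<open>Markov chains of finite order and their window chains\<close>

text \<open>A vector of length \<open>q\<close> is an extensional function on \<open>{..<q}\<close>.\<close>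

abbreviation vecs :: "nat \<Rightarrow> (nat \<Rightarrow> 'y::polish_space) measure" where
  "vecs q \<equiv> PiM {..<q} (\<lambda>_. borel)"

text \<open>The vector \<open>(y\<^sub>t, y\<^sub>t\<^sub>-\<^sub>1, \<dots>)\<close> of length \<open>q\<close>, most recent value first.
  Thus \<open>X\<^sub>t\<close> is the window of length \<open>p + 1\<close> at \<open>t\<close>.\<close>

definition window :: "nat \<Rightarrow> (int \<Rightarrow> 'y) \<Rightarrow> int \<Rightarrow> nat \<Rightarrow> 'y" where
  "window q y t = (\<lambda>i\<in>{..<q}. y (t - int i))"

definition past_algebra :: "'w measure \<Rightarrow> (int \<Rightarrow> 'w \<Rightarrow> 'y::polish_space) \<Rightarrow> int \<Rightarrow> 'w measure" where
  "past_algebra M Y t =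
     vimage_algebra (space M) (\<lambda>\<omega>. \<lambda>s\<in>{..<t}. Y s \<omega>) (PiM {..<t} (\<lambda>_. borel))"

text \<open>Time homogeneity is the independence of the transition kernel \<open>\<kappa>\<close> from \<open>t\<close>. The kernel is
  part of the data because the process determines it only up to null sets.\<close>

definition markov_chain_of_order ::
  "nat \<Rightarrow> ((nat \<Rightarrow> 'y) \<Rightarrow> 'y measure) \<Rightarrow> 'w measure \<Rightarrow> (int \<Rightarrow> 'w \<Rightarrow> 'y::polish_space) \<Rightarrow> bool" where
  "markov_chain_of_order k \<kappa> M Y \<longleftrightarrow>
     prob_space M \<and>
     \<kappa> \<in> vecs k \<rightarrow>\<^sub>M prob_algebra borel \<and>
     (\<forall>t. Y t \<in> M \<rightarrow>\<^sub>M borel) \<and>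
     (\<forall>t. \<forall>A\<in>sets borel. AE \<omega> in M.
        real_cond_exp M (past_algebra M Y t) (\<lambda>\<omega>. indicator A (Y t \<omega>)) \<omega>
        = measure (\<kappa> (window k (\<lambda>s. Y s \<omega>) (t - 1))) A)"

definition stationary :: "'w measure \<Rightarrow> (int \<Rightarrow> 'w \<Rightarrow> 'y::polish_space) \<Rightarrow> bool" where
  "stationary M Y \<longleftrightarrow>
     (\<forall>h. distr M (PiM UNIV (\<lambda>_. borel)) (\<lambda>\<omega> t. Y (t + h) \<omega>)
        = distr M (PiM UNIV (\<lambda>_. borel)) (\<lambda>\<omega> t. Y t \<omega>))"

text \<open>The kernel of the chain of windows of length \<open>q \<ge> k\<close>: draw a new value from \<open>\<kappa>\<close>, put it in
  front and drop the oldest value.\<close>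

definition window_kernel ::
  "nat \<Rightarrow> ((nat \<Rightarrow> 'y) \<Rightarrow> 'y measure) \<Rightarrow> nat \<Rightarrow> (nat \<Rightarrow> 'y::polish_space) \<Rightarrow> (nat \<Rightarrow> 'y) measure" where
  "window_kernel k \<kappa> q x =
     distr (\<kappa> (restrict x {..<k})) (vecs q) (\<lambda>y. restrict (case_nat y x) {..<q})"

text \<open>By stationarity the choice of time \<open>0\<close> does not matter.\<close>

definition window_law :: "nat \<Rightarrow> 'w measure \<Rightarrow> (int \<Rightarrow> 'w \<Rightarrow> 'y::polish_space) \<Rightarrow> (nat \<Rightarrow> 'y) measure" where
  "window_law q M Y = distr M (vecs q) (\<lambda>\<omega>. window q (\<lambda>s. Y s \<omega>) 0)"


section \<open>Ergodicity and mixing time\<close>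

definition tv_dist :: "'a measure \<Rightarrow> 'a measure \<Rightarrow> real" where
  "tv_dist P P' = (SUP A\<in>sets P. \<bar>measure P A - measure P' A\<bar>)"

primrec kernel_power :: "'a measure \<Rightarrow> ('a \<Rightarrow> 'a measure) \<Rightarrow> nat \<Rightarrow> 'a \<Rightarrow> 'a measure" where
  "kernel_power S K 0 x = return S x"
| "kernel_power S K (Suc n) x = kernel_power S K n x \<bind> K"

definition max_tv_dist :: "'a measure \<Rightarrow> ('a \<Rightarrow> 'a measure) \<Rightarrow> 'a measure \<Rightarrow> nat \<Rightarrow> real" where
  "max_tv_dist S K Q n = (SUP x\<in>space S. tv_dist (kernel_power S K n x) Q)"

definition uniformly_ergodic :: "'a measure \<Rightarrow> ('a \<Rightarrow> 'a measure) \<Rightarrow> 'a measure \<Rightarrow> bool" where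
  "uniformly_ergodic S K Q \<longleftrightarrow>
     (\<exists>C \<rho>. 0 < C \<and> 0 < \<rho> \<and> \<rho> < 1 \<and> (\<forall>n. max_tv_dist S K Q n \<le> C * \<rho> ^ n))"

definition mixing_time :: "'a measure \<Rightarrow> ('a \<Rightarrow> 'a measure) \<Rightarrow> 'a measure \<Rightarrow> nat" where
  "mixing_time S K Q = (LEAST t. 1 \<le> t \<and> max_tv_dist S K Q t \<le> 1 / 4)"


section \<open>Conditional law of the validation set\<close>

text \<open>In the Ionescu-Tulcea construction below, coordinate \<open>i\<close> is \<open>X\<^sub>i\<^sub>+\<^sub>1\<close>: the chain has initial
  law \<open>Q\<close> and one-step kernel \<open>K\<close>, and \<open>Ionescu_Tulcea.C \<dots> n m h\<close> is the law of the first \<open>n + m\<close>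
  coordinates given that the first \<open>n\<close> of them equal \<open>h\<close>.\<close>

definition chain_step ::
  "('a \<Rightarrow> 'a measure) \<Rightarrow> 'a measure \<Rightarrow> nat \<Rightarrow> (nat \<Rightarrow> 'a) \<Rightarrow> 'a measure" where
  "chain_step K Q i h = (case i of 0 \<Rightarrow> Q | Suc j \<Rightarrow> K (h j))"

lemma Ionescu_Tulcea_chain_step:
  assumes K: "K \<in> S \<rightarrow>\<^sub>M prob_algebra S" and Q: "Q \<in> space (prob_algebra S)"
  shows "Ionescu_Tulcea (chain_step K Q) (\<lambda>_. S)"
proof -
  have *: "chain_step K Q i \<in> PiM {0..<i} (\<lambda>_. S) \<rightarrow>\<^sub>M prob_algebra S" for i
  proof (cases i)
    case 0
    then show ?thesis
      using measurable_const[OF Q, of "PiM {0..<i} (\<lambda>_. S)"] by (simp add: chain_step_def[abs_def])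
  next
    case (Suc j)
    have "(\<lambda>h. h j) \<in> PiM {0..<i} (\<lambda>_. S) \<rightarrow>\<^sub>M S"
      using Suc by (intro measurable_component_singleton) simp
    from measurable_compose[OF this K] show ?thesis
      by (simp add: chain_step_def[abs_def] Suc)
  qed
  show ?thesis
  proof (rule Ionescu_Tulcea.intro)
    show "chain_step K Q i \<in> PiM {0..<i} (\<lambda>_. S) \<rightarrow>\<^sub>M subprob_algebra S" for i
      by (rule measurable_prob_algebraD[OF *])
    show "prob_space (chain_step K Q i h)" if "h \<in> space (PiM {0..<i} (\<lambda>_. S))" for i h
      using measurable_space[OF *[of i] that] by (simp add: space_prob_algebra)
  qed
qed

text \<open>The law of \<open>(X\<^sub>n\<^sub>+\<^sub>1, \<dots>, X\<^sub>n\<^sub>+\<^sub>m)\<close> given \<open>X\<^sub>1 = x\<^sub>1, \<dots>, X\<^sub>n = x\<^sub>n\<close>, with the indices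
  \<open>n + 1, \<dots>, n + m\<close> restored.\<close>

definition validation_law ::
  "'a measure \<Rightarrow> ('a \<Rightarrow> 'a measure) \<Rightarrow> 'a measure \<Rightarrow> nat \<Rightarrow> nat \<Rightarrow> (nat \<Rightarrow> 'a) \<Rightarrow> (nat \<Rightarrow> 'a) measure" where
  "validation_law S K Q n m x =
     distr (Ionescu_Tulcea.C (chain_step K Q) (\<lambda>_. S) n m (\<lambda>i\<in>{0..<n}. x (Suc i)))
       (PiM {n+1..n+m} (\<lambda>_. S)) (\<lambda>h. \<lambda>j\<in>{n+1..n+m}. h (j - 1))"

lemma window_kernel_measurable:
  fixes \<kappa> :: "(nat \<Rightarrow> 'y::polish_space) \<Rightarrow> 'y measure"
  assumes \<kappa>: "\<kappa> \<in> vecs k \<rightarrow>\<^sub>M prob_algebra borel" and "k \<le> q"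
  shows "window_kernel k \<kappa> q \<in> vecs q \<rightarrow>\<^sub>M prob_algebra (vecs q)"
proof -
  have 1: "(\<lambda>x. \<kappa> (restrict x {..<k})) \<in> vecs q \<rightarrow>\<^sub>M prob_algebra borel"
    using \<open>k \<le> q\<close> by (intro measurable_compose[OF _ \<kappa>] measurable_restrict_subset) auto
  have 2: "(\<lambda>(x, y). restrict (case_nat y x) {..<q}) \<in> vecs q \<Otimes>\<^sub>M (borel :: 'y measure) \<rightarrow>\<^sub>M vecs q"
    unfolding split_beta
  proof (rule measurable_restrict)
    fix i assume "i \<in> {..<q}"
    then show "(\<lambda>z. case_nat (snd z) (fst z) i) \<in> vecs q \<Otimes>\<^sub>M (borel :: 'y measure) \<rightarrow>\<^sub>M (borel :: 'y measure)"
      by (cases i) (auto intro!: measurable_compose[OF measurable_fst measurable_component_singleton])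
  qed
  show ?thesis
    unfolding window_kernel_def[abs_def]
    by (rule measurable_distr_prob_space2[OF 1 2])
qed


section \<open>Losses and predictors\<close>

definition loss_function :: "('y::polish_space \<times> 'y \<Rightarrow> real) \<Rightarrow> bool" where
  "loss_function L \<longleftrightarrow> L \<in> borel_measurable borel \<and> range L \<subseteq> {0..1}"

definition predictors :: "nat \<Rightarrow> ((nat \<Rightarrow> 'y::polish_space) \<Rightarrow> 'y) set" where
  "predictors p = vecs p \<rightarrow>\<^sub>M borel"

text \<open>Here \<open>x = (y\<^sub>t, \<dots>, y\<^sub>t\<^sub>-\<^sub>p)\<close> and \<open>g\<close> is applied to \<open>(y\<^sub>t\<^sub>-\<^sub>1, \<dots>, y\<^sub>t\<^sub>-\<^sub>p)\<close>.\<close>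

definition loss_at ::
  "nat \<Rightarrow> ('y \<times> 'y \<Rightarrow> real) \<Rightarrow> ((nat \<Rightarrow> 'y) \<Rightarrow> 'y) \<Rightarrow> (nat \<Rightarrow> 'y) \<Rightarrow> real" where
  "loss_at p L g x = L (g (\<lambda>i\<in>{..<p}. x (Suc i)), x 0)"

definition expected_loss ::
  "nat \<Rightarrow> ('y \<times> 'y \<Rightarrow> real) \<Rightarrow> (nat \<Rightarrow> 'y) measure \<Rightarrow> ((nat \<Rightarrow> 'y) \<Rightarrow> 'y) \<Rightarrow> real" where
  "expected_loss p L Q g = (\<integral>x. loss_at p L g x \<partial>Q)"

definition empirical_loss ::
  "nat \<Rightarrow> ('y \<times> 'y \<Rightarrow> real) \<Rightarrow> nat \<Rightarrow> nat \<Rightarrow> (nat \<Rightarrow> nat \<Rightarrow> 'y) \<Rightarrow> ((nat \<Rightarrow> 'y) \<Rightarrow> 'y) \<Rightarrow> real" where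
  "empirical_loss p L n m v g = (\<Sum>j=n+1..n+m. loss_at p L g (v j)) / real m"

end

theory Submission
  imports Defs
begin

text \<open>A contraction argument shows that the mean loss over \<open>m\<close> steps, started anywhere, differs from
  the stationary one by at most \<open>2 \<tau>\<close>, where \<open>\<tau> = t\<^sub>m\<^sub>i\<^sub>x / m\<close>: every \<open>t\<^sub>m\<^sub>i\<^sub>x\<close> steps halve the oscillation
  of a function. Cut the path into blocks of length \<open>t\<^sub>m\<^sub>i\<^sub>x\<close>. Given the past, the conditional
  expectation of the total loss varies by at most \<open>3 t\<^sub>m\<^sub>i\<^sub>x\<close> over a block, namely \<open>t\<^sub>m\<^sub>i\<^sub>x\<close> within the block
  and \<open>2 t\<^sub>m\<^sub>i\<^sub>x\<close> through its last state, so Hoeffding's lemma applied block by block bounds the moment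
  generating function of a deviation at \<open>l\<close> by \<open>exp (2 l \<tau> + 9/4 l\<^sup>2 \<tau>)\<close> when \<open>\<tau> \<le> 1\<close>. The tail bounds
  follow from Chernoff's method and a union bound over the \<open>N\<close> predictors, the bounds in mean from
  the maximal inequality; both are trivial when \<open>\<tau> > 1\<close>.\<close>

section \<open>expected_sum variation and oscillation\<close>

lemma tv_dist_ge_measure:
  assumes "prob_space P" "prob_space Q" "A \<in> sets P"
  shows "\<bar>measure P A - measure Q A\<bar> \<le> tv_dist P Q"
  unfolding tv_dist_def
proof (rule cSUP_upper[OF assms(3)])
  show "bdd_above ((\<lambda>A. \<bar>measure P A - measure Q A\<bar>) ` sets P)"
  proof (rule bdd_aboveI2)
    fix A show "\<bar>measure P A - measure Q A\<bar> \<le> 1"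
      using prob_space.prob_le_1[OF assms(1), of A] prob_space.prob_le_1[OF assms(2), of A]
        measure_nonneg[of P A] measure_nonneg[of Q A] by linarith
  qed
qed

lemma tv_dist_le_1:
  assumes "prob_space P" "prob_space Q"
  shows "tv_dist P Q \<le> 1"
  unfolding tv_dist_def
proof (rule cSUP_least)
  fix A show "\<bar>measure P A - measure Q A\<bar> \<le> 1"
    using prob_space.prob_le_1[OF assms(1), of A] prob_space.prob_le_1[OF assms(2), of A]
      measure_nonneg[of P A] measure_nonneg[of Q A] by linarith
qed auto

text \<open>\<open>f\<close> is within \<open>1 / k\<close> of the average of the indicators of its superlevel sets
  \<open>{i / k \<le> f}\<close>, \<open>1 \<le> i \<le> k\<close>.\<close>

lemma tv_dist_integral_le:
  fixes f :: "'a \<Rightarrow> real"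
  assumes P: "prob_space P" and Q: "prob_space Q"
    and sP: "sets P = sets S" and sQ: "sets Q = sets S"
    and f[measurable]: "f \<in> borel_measurable S"
    and f01: "\<And>x. x \<in> space S \<Longrightarrow> 0 \<le> f x \<and> f x \<le> 1"
  shows "(\<integral>x. f x \<partial>P) - (\<integral>x. f x \<partial>Q) \<le> tv_dist P Q"
proof -
  interpret P: prob_space P by fact
  interpret Q: prob_space Q by fact
  note [measurable_cong] = sP sQ
  have spP: "space P = space S" and spQ: "space Q = space S"
    using sP sQ by (auto dest: sets_eq_imp_space_eq)
  have intP: "integrable P f" and intQ: "integrable Q f"
    using f01 spP spQ
    by (auto intro!: P.integrable_const_bound[where B=1] Q.integrable_const_bound[where B=1])
  have "(\<integral>x. f x \<partial>P) - (\<integral>x. f x \<partial>Q) \<le> tv_dist P Q + 1 / real (Suc k')" for k'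
  proof -
    obtain k where k: "k = Suc k'" by simp
    then have k0: "0 < k" by simp
    define B where "B i = {x\<in>space S. real i \<le> real k * f x}" for i
    define D where "D x = (\<Sum>i=1..k. indicator (B i) x) / real k" for x
    have B[measurable]: "B i \<in> sets S" for i unfolding B_def by measurable
    have D: "f x - 1 / real k \<le> D x \<and> D x \<le> f x" if x: "x \<in> space S" for x
    proof -
      define c where "c = real k * f x"
      have c: "0 \<le> c" "c \<le> real k" using f01[OF x] by (auto simp: c_def mult_left_le)
      \<comment> \<open>Of the thresholds 1, ..., k exactly those up to the floor of
        \<open>c\<close> are passed, so \<open>D x\<close> is \<open>f x\<close> rounded down to a
        multiple of \<open>1 / k\<close>.\<close>
      have "(\<Sum>i=1..k. indicator (B i) x) = real (card {i\<in>{1..k}. real i \<le> c})"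
        unfolding B_def c_def using x
        by (simp add: indicator_def sum.If_cases Int_def)
      also have "{i\<in>{1..k}. real i \<le> c} = {1..nat \<lfloor>c\<rfloor>}"
        using c by (auto simp: le_nat_floor le_floor_iff) linarith+
      finally have "(\<Sum>i=1..k. indicator (B i) x) = real (nat \<lfloor>c\<rfloor>)" by simp
      then have "D x = real (nat \<lfloor>c\<rfloor>) / real k" by (simp add: D_def)
      moreover have "c - 1 \<le> real (nat \<lfloor>c\<rfloor>)" "real (nat \<lfloor>c\<rfloor>) \<le> c" using c by linarith+
      moreover have "f x = c / real k" using k0 by (simp add: c_def)
      ultimately show ?thesis using k0
        by (auto simp flip: diff_divide_distrib intro!: divide_right_mono)
    qed
    have indP: "integrable P (indicat_real (B i))" and indQ: "integrable Q (indicat_real (B i))" for i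
      by (auto intro!: P.integrable_const_bound[where B=1] Q.integrable_const_bound[where B=1])
    have iP: "(\<integral>x. D x \<partial>P) = (\<Sum>i=1..k. measure P (B i)) / real k"
      unfolding D_def by (subst integral_divide_zero, subst Bochner_Integration.integral_sum)
        (auto simp: spP sP sets.Int_space_eq2 B indP)
    have iQ: "(\<integral>x. D x \<partial>Q) = (\<Sum>i=1..k. measure Q (B i)) / real k"
      unfolding D_def by (subst integral_divide_zero, subst Bochner_Integration.integral_sum)
        (auto simp: spQ sQ sets.Int_space_eq2 B indQ)
    have DP: "integrable P D" and DQ: "integrable Q D" unfolding D_def using indP indQ by auto
    have "(\<integral>x. f x \<partial>P) - 1 / real k = (\<integral>x. f x - 1 / real k \<partial>P)"
      using intP by (simp add: P.prob_space)
    also have "\<dots> \<le> (\<integral>x. D x \<partial>P)"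
      using D spP intP DP by (intro integral_mono) auto
    also have "\<dots> \<le> (\<Sum>i=1..k. measure Q (B i) + tv_dist P Q) / real k"
    proof -
      have "measure P (B i) \<le> measure Q (B i) + tv_dist P Q" for i
        using tv_dist_ge_measure[OF P Q, of "B i"] B[of i] sP by auto
      then show ?thesis unfolding iP by (intro divide_right_mono sum_mono) auto
    qed
    also have "\<dots> = (\<integral>x. D x \<partial>Q) + tv_dist P Q"
      unfolding iQ using k0 by (simp add: sum.distrib field_simps)
    also have "(\<integral>x. D x \<partial>Q) \<le> (\<integral>x. f x \<partial>Q)"
      using D spQ intQ DQ by (intro integral_mono) auto
    finally show ?thesis by (simp add: k)
  qed
  moreover have "(\<lambda>k. tv_dist P Q + 1 / real (Suc k)) \<longlonglongrightarrow> tv_dist P Q + 0"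
    using LIMSEQ_inverse_real_of_nat by (intro tendsto_intros) (simp add: inverse_eq_divide)
  ultimately show ?thesis
    using LIMSEQ_le_const by fastforce
qed

text \<open>The left end is the infimum. Rescaling to the unit interval and Hoeffding's lemma both
  ask for an enclosing interval, whereas contraction controls differences of values.\<close>

lemma osc_interval:
  fixes f :: "'a \<Rightarrow> real"
  assumes "X \<noteq> {}" and osc: "\<And>x y. x \<in> X \<Longrightarrow> y \<in> X \<Longrightarrow> f x - f y \<le> c"
  obtains a where "\<And>x. x \<in> X \<Longrightarrow> a \<le> f x \<and> f x \<le> a + c"
proof -
  obtain x0 where x0: "x0 \<in> X" using assms(1) by auto
  define a where "a = (INF x\<in>X. f x)"
  have bdd: "bdd_below (f ` X)"
    using osc[OF x0] by (intro bdd_belowI2[where m="f x0 - c"]) (auto simp: algebra_simps)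
  have "a \<le> f x \<and> f x \<le> a + c" if x: "x \<in> X" for x
  proof
    show "a \<le> f x" unfolding a_def by (rule cINF_lower[OF bdd x])
    have "f x - c \<le> a" unfolding a_def using x0 osc[OF x]
      by (intro cINF_greatest) (auto simp: algebra_simps)
    then show "f x \<le> a + c" by simp
  qed
  then show thesis by (rule that)
qed

text \<open>An affine change of scale reduces this to values in the unit interval. No factor 2
  appears, since \<open>tv_dist\<close> is a supremum over sets.\<close>

lemma tv_dist_integral_le_osc:
  fixes f :: "'a \<Rightarrow> real"
  assumes P: "prob_space P" and Q: "prob_space Q"
    and sP: "sets P = sets S" and sQ: "sets Q = sets S"
    and f[measurable]: "f \<in> borel_measurable S"
    and osc: "\<And>x y. x \<in> space S \<Longrightarrow> y \<in> space S \<Longrightarrow> f x - f y \<le> c"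
  shows "(\<integral>x. f x \<partial>P) - (\<integral>x. f x \<partial>Q) \<le> c * tv_dist P Q"
proof -
  interpret P: prob_space P by fact
  interpret Q: prob_space Q by fact
  note [measurable_cong] = sP sQ
  have spP: "space P = space S" and spQ: "space Q = space S"
    using sP sQ by (auto dest: sets_eq_imp_space_eq)
  obtain x0 where x0: "x0 \<in> space S" using P.not_empty spP by auto
  have c0: "0 \<le> c" using osc[OF x0 x0] by simp
  obtain a where a: "\<And>x. x \<in> space S \<Longrightarrow> a \<le> f x \<and> f x \<le> a + c"
    using osc_interval[of "space S" f c] osc x0 by blast
  \<comment> \<open>For \<open>c = 0\<close> division by zero makes \<open>g\<close> vanish, and
    \<open>f\<close> is then the constant \<open>a\<close>, so \<open>f x = a + c * g x\<close> on
    \<open>space S\<close> in every case.\<close>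
  define g where "g x = (f x - a) / c" for x
  have [measurable]: "g \<in> borel_measurable S" unfolding g_def by measurable
  have fg: "f x = a + c * g x" if "x \<in> space S" for x
    using a[OF that] c0 by (cases "c = 0") (auto simp: g_def)
  have g01: "0 \<le> g x \<and> g x \<le> 1" if "x \<in> space S" for x
    using a[OF that] c0 by (cases "c = 0") (auto simp: g_def field_simps)
  have intP: "integrable P g" and intQ: "integrable Q g"
    using g01 spP spQ
    by (auto intro!: P.integrable_const_bound[where B=1] Q.integrable_const_bound[where B=1])
  have "(\<integral>x. f x \<partial>P) = (\<integral>x. a + c * g x \<partial>P)"
    by (intro Bochner_Integration.integral_cong) (auto simp: spP fg)
  also have "\<dots> = a + c * (\<integral>x. g x \<partial>P)" using intP by (simp add: P.prob_space)
  finally have 1: "(\<integral>x. f x \<partial>P) = a + c * (\<integral>x. g x \<partial>P)" .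
  have "(\<integral>x. f x \<partial>Q) = (\<integral>x. a + c * g x \<partial>Q)"
    by (intro Bochner_Integration.integral_cong) (auto simp: spQ fg)
  also have "\<dots> = a + c * (\<integral>x. g x \<partial>Q)" using intQ by (simp add: Q.prob_space)
  finally have 2: "(\<integral>x. f x \<partial>Q) = a + c * (\<integral>x. g x \<partial>Q)" .
  have "(\<integral>x. g x \<partial>P) - (\<integral>x. g x \<partial>Q) \<le> tv_dist P Q"
    using g01 by (intro tv_dist_integral_le[OF P Q sP sQ]) auto
  from mult_left_mono[OF this c0] show ?thesis by (simp add: 1 2 algebra_simps)
qed

lemma tv_dist_integral_abs_le_osc:
  fixes f :: "'a \<Rightarrow> real"
  assumes "prob_space P" "prob_space Q" "sets P = sets S" "sets Q = sets S"
    and f: "f \<in> borel_measurable S"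
    and osc: "\<And>x y. x \<in> space S \<Longrightarrow> y \<in> space S \<Longrightarrow> f x - f y \<le> c"
  shows "\<bar>(\<integral>x. f x \<partial>P) - (\<integral>x. f x \<partial>Q)\<bar> \<le> c * tv_dist P Q"
  using tv_dist_integral_le_osc[OF assms(1-4) f osc]
    tv_dist_integral_le_osc[OF assms(1-4) borel_measurable_uminus[OF f], of c] osc
  by force

text \<open>The first \<open>t\<close> summands are 1 and the others form half of the same sum with
  \<open>m - t\<close> terms; \<open>2 t\<close> is the fixed point of
  \<open>s = t + s / 2\<close>.\<close>

lemma sum_geometric_blocks_le:
  fixes m t :: nat
  assumes "1 \<le> t"
  shows "(\<Sum>j<m. (1/2::real) ^ (j div t)) \<le> 2 * real t"
proof (induction m rule: less_induct)
  case (less m)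
  show ?case
  proof (cases "m \<le> t")
    case True
    have "(\<Sum>j<m. (1/2::real) ^ (j div t)) \<le> (\<Sum>j<m. 1)"
      by (intro sum_mono) (simp add: power_le_one)
    then show ?thesis using True by simp
  next
    case False
    then obtain r where r: "m = t + r" "r < m" using assms by (metis le_add_diff_inverse nle_le diff_less le_trans less_eq_Suc_le One_nat_def)
    have "(\<Sum>j<m. (1/2::real) ^ (j div t)) = (\<Sum>j<t. (1/2) ^ (j div t)) + (\<Sum>j<r. (1/2) ^ ((t + j) div t))"
      unfolding r(1) by (induction r) (simp_all add: add.assoc)
    also have "(\<Sum>j<t. (1/2::real) ^ (j div t)) = real t" by simp
    also have "(\<Sum>j<r. (1/2::real) ^ ((t + j) div t)) = (1/2) * (\<Sum>j<r. (1/2) ^ (j div t))"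
      using assms by (simp add: sum_distrib_left)
    finally show ?thesis using less.IH[OF r(2)] by simp
  qed
qed

section \<open>Contraction of Markov kernels\<close>

locale markov_kernel =
  fixes S :: "'a measure" and K :: "'a \<Rightarrow> 'a measure"
  assumes kernel: "K \<in> S \<rightarrow>\<^sub>M prob_algebra S"
begin

lemma kernel_power_measurable: "kernel_power S K n \<in> S \<rightarrow>\<^sub>M prob_algebra S"
proof (induction n)
  case 0
  have "kernel_power S K 0 = return S" by (simp add: fun_eq_iff)
  then show ?case by simp
next
  case (Suc n)
  then show ?case
    using measurable_bind_prob_space[OF Suc kernel] by (simp cong: measurable_cong)
qed

lemmas kernel_power_subprob = measurable_prob_algebraD[OF kernel_power_measurable]

lemma
  assumes "x \<in> space S"
  shows prob_space_kernel_power: "prob_space (kernel_power S K n x)"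
    and sets_kernel_power: "sets (kernel_power S K n x) = sets S"
  using measurable_space[OF kernel_power_measurable assms, of n]
  by (auto simp: space_prob_algebra)

lemma space_kernel_power: "x \<in> space S \<Longrightarrow> space (kernel_power S K n x) = space S"
  using sets_kernel_power by (rule sets_eq_imp_space_eq)

text \<open>Chapman-Kolmogorov. \<open>kernel_power\<close> appends steps at the end, while the
  later arguments condition on the state after the first \<open>m\<close> steps; associativity of
  bind moves the cut.\<close>

lemma kernel_power_add:
  assumes x: "x \<in> space S"
  shows "kernel_power S K (m + n) x = kernel_power S K m x \<bind> kernel_power S K n"
proof (induction n)
  case 0
  have "kernel_power S K 0 = return S" by (simp add: fun_eq_iff)
  then show ?case using bind_return''[OF sets_kernel_power[OF x]] by simp
next
  case (Suc n)
  have "kernel_power S K (m + Suc n) x = (kernel_power S K m x \<bind> kernel_power S K n) \<bind> K"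
    using Suc by simp
  also have "\<dots> = kernel_power S K m x \<bind> (\<lambda>y. kernel_power S K n y \<bind> K)"
    by (intro bind_assoc[where N=S and R=S] measurable_prob_algebraD[OF kernel])
      (simp add: kernel_power_subprob measurable_cong_sets[OF sets_kernel_power[OF x] refl])
  finally show ?case by simp
qed

lemma kernel_power_1: "x \<in> space S \<Longrightarrow> kernel_power S K (Suc 0) x = K x"
  using measurable_prob_algebraD[OF kernel] by (simp add: bind_return)

lemma nn_integral_kernel_power_add:
  assumes x: "x \<in> space S" and g: "g \<in> borel_measurable S"
  shows "(\<integral>\<^sup>+y. g y \<partial>kernel_power S K (m + n) x)
    = (\<integral>\<^sup>+z. \<integral>\<^sup>+y. g y \<partial>kernel_power S K n z \<partial>kernel_power S K m x)"
  unfolding kernel_power_add[OF x]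
  by (intro nn_integral_bind[OF g])
    (simp add: kernel_power_subprob measurable_cong_sets[OF sets_kernel_power[OF x] refl])

text \<open>The \<open>n\<close>-th power of the Markov operator, the action of the kernel on
  functions instead of measures.\<close>

definition expect_after :: "nat \<Rightarrow> ('a \<Rightarrow> real) \<Rightarrow> 'a \<Rightarrow> real" where
  "expect_after n g x = (\<integral>y. g y \<partial>kernel_power S K n x)"

lemma expect_after_measurable [measurable]:
  "g \<in> borel_measurable S \<Longrightarrow> expect_after n g \<in> borel_measurable S"
  unfolding expect_after_def[abs_def]
  by (intro measurable_compose[OF kernel_power_subprob integral_measurable_subprob_algebra])

lemma integrable_kernel_power:
  fixes g :: "'a \<Rightarrow> real"
  assumes "x \<in> space S" "g \<in> borel_measurable S" "\<And>y. y \<in> space S \<Longrightarrow> \<bar>g y\<bar> \<le> B"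
  shows "integrable (kernel_power S K n x) g"
proof -
  interpret prob_space "kernel_power S K n x" by (rule prob_space_kernel_power) fact
  show ?thesis
    using assms space_kernel_power[OF assms(1)]
    by (intro integrable_const_bound[where B=B])
      (auto simp: measurable_cong_sets[OF sets_kernel_power refl])
qed

lemma expect_after_bounds:
  assumes x: "x \<in> space S" and g: "g \<in> borel_measurable S"
    and b: "\<And>y. y \<in> space S \<Longrightarrow> a \<le> g y \<and> g y \<le> b"
  shows "a \<le> expect_after n g x \<and> expect_after n g x \<le> b"
proof -
  interpret prob_space "kernel_power S K n x" by (rule prob_space_kernel_power) fact
  have i: "integrable (kernel_power S K n x) g"
    by (rule integrable_kernel_power[OF x g, of "\<bar>a\<bar> + \<bar>b\<bar>"]) (use b in fastforce)
  show ?thesis unfolding expect_after_def using b i space_kernel_power[OF x]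
    by (auto intro!: integral_ge_const integral_le_const)
qed

lemma expect_after_add:
  assumes x: "x \<in> space S" and g: "g \<in> borel_measurable S"
    and b: "\<And>y. y \<in> space S \<Longrightarrow> \<bar>g y\<bar> \<le> B"
  shows "expect_after (m + n) g x = expect_after m (expect_after n g) x"
proof -
  interpret prob_space "kernel_power S K m x" by (rule prob_space_kernel_power) fact
  show ?thesis unfolding expect_after_def kernel_power_add[OF x]
  proof (rule integral_bind[OF g b, where B'=1])
    show "kernel_power S K n \<in> kernel_power S K m x \<rightarrow>\<^sub>M subprob_algebra S"
      by (simp add: kernel_power_subprob measurable_cong_sets[OF sets_kernel_power[OF x] refl])
    show "AE y in kernel_power S K m x.
      emeasure (kernel_power S K n y) (space (kernel_power S K n y)) \<le> ennreal 1"
      using prob_space.emeasure_space_1[OF prob_space_kernel_power]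
      by (auto simp: space_kernel_power[OF x])
  qed (auto intro: finite_measure_axioms)
qed

end

text \<open>What uniform ergodicity supplies: \<open>contraction\<close> at the single time
  \<open>t\<close> drives the quantitative bounds, and \<open>convergence\<close> identifies
  \<open>Q\<close> as invariant. \<open>f\<close> stands for the loss of one predictor, or for 1
  minus that loss.\<close>

locale mixing_chain = markov_kernel S K for S :: "'a measure" and K +
  fixes Q :: "'a measure" and t :: nat and f :: "'a \<Rightarrow> real"
  assumes prob_Q: "prob_space Q" and sets_Q: "sets Q = sets S" and t_ge_1: "1 \<le> t"
    and contraction: "\<And>x. x \<in> space S \<Longrightarrow> tv_dist (kernel_power S K t x) Q \<le> 1/4"
    and convergence: "\<And>x. x \<in> space S \<Longrightarrow> (\<lambda>n. tv_dist (kernel_power S K n x) Q) \<longlonglongrightarrow> 0"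
    and f_measurable [measurable]: "f \<in> borel_measurable S"
    and f_range: "\<And>x. x \<in> space S \<Longrightarrow> 0 \<le> f x \<and> f x \<le> 1"
begin

text \<open>If a function oscillates by at most \<open>c\<close>, its expectation after
  \<open>t\<close> steps is within \<open>c / 4\<close> of its mean under \<open>Q\<close> from
  every start, hence oscillates by at most \<open>c / 2\<close>. The induction takes off the first
  \<open>t\<close> steps.\<close>

lemma expect_after_osc:
  assumes "x \<in> space S" "y \<in> space S"
  shows "expect_after j f x - expect_after j f y \<le> (1/2) ^ (j div t)"
  using assms
proof (induction j arbitrary: x y rule: less_induct)
  case (less j)
  show ?case
  \<comment> \<open>Before \<open>t\<close> steps are complete the exponent is 0, and the bound 1
    comes from the range of \<open>f\<close>.\<close>
  proof (cases "j < t")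
    case True
    then show ?thesis
      using expect_after_bounds[OF less.prems(1) f_measurable f_range, of j]
        expect_after_bounds[OF less.prems(2) f_measurable f_range, of j] by simp
  next
    case False
    then obtain r where r: "j = t + r" by (metis le_Suc_ex not_less)
    have rj: "r < j" using r t_ge_1 by simp
    let ?c = "(1/2) ^ (r div t) :: real"
    let ?g = "expect_after r f"
    have osc: "?g x - ?g y \<le> ?c" if "x \<in> space S" "y \<in> space S" for x y
      by (rule less.IH[OF rj that])
    have E: "expect_after j f x = expect_after t ?g x" if "x \<in> space S" for x
      unfolding r by (rule expect_after_add[OF that f_measurable, where B=1]) (use f_range in auto)
    have c: "?c * tv_dist (kernel_power S K t x) Q \<le> ?c * (1/4)" if "x \<in> space S" for x
      by (intro mult_left_mono contraction that) auto
    have "\<bar>expect_after t ?g x - (\<integral>y. ?g y \<partial>Q)\<bar> \<le> ?c * (1/4)" if "x \<in> space S" for x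
      using tv_dist_integral_abs_le_osc[OF prob_space_kernel_power[OF that, of t] prob_Q
        sets_kernel_power[OF that] sets_Q expect_after_measurable[OF f_measurable] osc] c[OF that]
      unfolding expect_after_def by (rule order_trans)
    from this[OF less.prems(1)] this[OF less.prems(2)]
    have "expect_after t ?g x - expect_after t ?g y \<le> ?c / 2" by linarith
    moreover have "j div t = Suc (r div t)" using r t_ge_1 by simp
    ultimately show ?thesis using E less.prems by simp
  qed
qed

lemma expect_after_tendsto:
  assumes x: "x \<in> space S" and g[measurable]: "g \<in> borel_measurable S"
    and g01: "\<And>y. y \<in> space S \<Longrightarrow> 0 \<le> g y \<and> g y \<le> 1"
  shows "(\<lambda>n. expect_after n g x) \<longlonglongrightarrow> (\<integral>y. g y \<partial>Q)"
proof -
  have osc: "g x - g y \<le> 1" if "x \<in> space S" "y \<in> space S" for x y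
    using g01[OF that(1)] g01[OF that(2)] by linarith
  have "\<bar>expect_after n g x - (\<integral>y. g y \<partial>Q)\<bar> \<le> tv_dist (kernel_power S K n x) Q" for n
    using tv_dist_integral_abs_le_osc[OF prob_space_kernel_power[OF x, of n] prob_Q
      sets_kernel_power[OF x] sets_Q g osc] by (simp add: expect_after_def)
  then show ?thesis
    by (intro LIM_zero_cancel[OF Lim_null_comparison[OF _ convergence[OF x]]]) auto
qed

lemma space_Q: "space Q = space S"
  using sets_Q by (rule sets_eq_imp_space_eq)

text \<open>Convergence from every starting point already forces \<open>Q\<close> to be invariant.\<close>

lemma expect_after_invariant: "(\<integral>x. expect_after j f x \<partial>Q) = (\<integral>x. f x \<partial>Q)"
proof -
  interpret Q: prob_space Q by (rule prob_Q)
  obtain x where x: "x \<in> space S" using Q.not_empty space_Q by auto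
  \<comment> \<open>One sequence, the expectation of \<open>f\<close> after \<open>n + j\<close>
    steps, converges to both integrals.\<close>
  have "(\<lambda>n. expect_after n (expect_after j f) x) \<longlonglongrightarrow> (\<integral>x. expect_after j f x \<partial>Q)"
    by (intro expect_after_tendsto x) (use expect_after_bounds[OF _ f_measurable f_range] in auto)
  moreover have "expect_after n (expect_after j f) x = expect_after (n + j) f x" for n
    by (rule expect_after_add[symmetric, OF x f_measurable, where B=1]) (use f_range in auto)
  moreover have "(\<lambda>n. expect_after (n + j) f x) \<longlonglongrightarrow> (\<integral>x. f x \<partial>Q)"
    by (intro LIMSEQ_ignore_initial_segment expect_after_tendsto x f_range f_measurable)
  ultimately show ?thesis by (auto intro: LIMSEQ_unique)
qed

text \<open>The expected total of \<open>f\<close> over the next \<open>m\<close> steps. The sum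
  starts after one step because the current state is already counted in the running total; added to
  that total it gives the Doob martingale of the final total.\<close>

definition expected_sum :: "nat \<Rightarrow> 'a \<Rightarrow> real" where
  "expected_sum m x = (\<Sum>i<m. expect_after (Suc i) f x)"

lemma expected_sum_measurable [measurable]: "expected_sum m \<in> borel_measurable S"
  unfolding expected_sum_def[abs_def] by measurable

lemma expected_sum_bounds:
  assumes "x \<in> space S" shows "0 \<le> expected_sum m x \<and> expected_sum m x \<le> real m"
proof -
  have "(\<Sum>i<m. expect_after (Suc i) f x) \<le> (\<Sum>i<m. 1)"
    using expect_after_bounds[OF assms f_measurable f_range] by (intro sum_mono) auto
  then show ?thesis using expect_after_bounds[OF assms f_measurable f_range]
    by (auto simp: expected_sum_def intro!: sum_nonneg)
qed

text \<open>The geometric loss of memory makes the influence of the start summable, so the bound is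
  independent of \<open>m\<close>.\<close>

lemma expected_sum_osc:
  assumes "x \<in> space S" "y \<in> space S"
  shows "expected_sum m x - expected_sum m y \<le> 2 * real t"
proof -
  have "expected_sum m x - expected_sum m y = (\<Sum>i<m. expect_after (Suc i) f x - expect_after (Suc i) f y)"
    by (simp add: expected_sum_def sum_subtractf)
  also have "\<dots> \<le> (\<Sum>i<m. (1/2) ^ (i div t))"
  proof (rule sum_mono)
    fix i
    \<comment> \<open>Weakening the exponent from \<open>Suc i\<close> to \<open>i\<close> gives the
      sum over blocks that starts at 0.\<close>
    have "(1/2::real) ^ (Suc i div t) \<le> (1/2) ^ (i div t)"
      by (intro power_decreasing div_le_mono) auto
    then show "expect_after (Suc i) f x - expect_after (Suc i) f y \<le> (1/2) ^ (i div t)"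
      using expect_after_osc[OF assms, of "Suc i"] by linarith
  qed
  also have "\<dots> \<le> 2 * real t" by (rule sum_geometric_blocks_le[OF t_ge_1])
  finally show ?thesis .
qed

text \<open>By invariance the mean of \<open>expected_sum m\<close> under \<open>Q\<close> is the
  stationary total, and no value exceeds the mean by more than the oscillation.\<close>

lemma expected_sum_le:
  assumes x: "x \<in> space S"
  shows "expected_sum m x \<le> real m * (\<integral>y. f y \<partial>Q) + 2 * real t"
proof -
  interpret Q: prob_space Q by (rule prob_Q)
  note [measurable_cong] = sets_Q
  have iE: "integrable Q (expect_after (Suc i) f)" for i
    using expect_after_bounds[OF _ f_measurable f_range]
    by (intro Q.integrable_const_bound[where B=1]) (auto simp: space_Q)
  have i: "integrable Q (expected_sum m)"
    unfolding expected_sum_def[abs_def] by (intro Bochner_Integration.integrable_sum iE)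
  have "(\<integral>y. expected_sum m y \<partial>Q) = real m * (\<integral>y. f y \<partial>Q)"
    unfolding expected_sum_def by (subst Bochner_Integration.integral_sum) (auto simp: iE expect_after_invariant)
  moreover have "expected_sum m x - 2 * real t \<le> (\<integral>y. expected_sum m y \<partial>Q)"
    using expected_sum_osc[OF x] i by (intro Q.integral_ge_const) (auto simp: space_Q algebra_simps)
  ultimately show ?thesis by simp
qed

text \<open>First-step analysis: this is the one-step martingale identity behind
  \<open>acc_mean\<close>.\<close>

lemma expected_sum_Suc:
  assumes x: "x \<in> space S"
  shows "(\<integral>y. f y + expected_sum m y \<partial>K x) = expected_sum (Suc m) x"
proof -
  have iE: "integrable (K x) (expect_after n f)" for n
  proof -
    have "\<bar>expect_after n f y\<bar> \<le> 1" if "y \<in> space S" for y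
      using expect_after_bounds[OF that f_measurable f_range, of n] by simp
    then show ?thesis
      using integrable_kernel_power[OF x, where n="Suc 0" and g="expect_after n f" and B=1]
      by (simp add: kernel_power_1[OF x] del: kernel_power.simps)
  qed
  have if': "integrable (K x) f"
    using integrable_kernel_power[OF x f_measurable, of 1 "Suc 0"] f_range kernel_power_1[OF x] by simp
  have E: "(\<integral>y. expect_after n f y \<partial>K x) = expect_after (Suc n) f x" for n
    using expect_after_add[OF x f_measurable, of 1 "Suc 0" n] f_range kernel_power_1[OF x]
    by (simp add: expect_after_def del: kernel_power.simps)
  have "(\<integral>y. f y + expected_sum m y \<partial>K x) = (\<integral>y. f y \<partial>K x) + (\<Sum>i<m. \<integral>y. expect_after (Suc i) f y \<partial>K x)"
    unfolding expected_sum_def using iE if'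
    by (subst Bochner_Integration.integral_add) (auto simp: Bochner_Integration.integral_sum)
  also have "(\<integral>y. f y \<partial>K x) = expect_after (Suc 0) f x"
    by (simp add: expect_after_def kernel_power_1[OF x] del: kernel_power.simps)
  also have "expect_after (Suc 0) f x + (\<Sum>i<m. \<integral>y. expect_after (Suc i) f y \<partial>K x) = expected_sum (Suc m) x"
    unfolding E expected_sum_def by (rule sum.lessThan_Suc_shift[symmetric])
  finally show ?thesis .
qed

end

section \<open>Exponential moments of additive functionals\<close>

context mixing_chain
begin

text \<open>The chain enriched by the running sum of \<open>f\<close>, so that path functionals become functions of
  the final state.\<close>

definition acc_step :: "real \<times> 'a \<Rightarrow> (real \<times> 'a) measure" where
  "acc_step z = distr (K (snd z)) (borel \<Otimes>\<^sub>M S) (\<lambda>y. (fst z + f y, y))"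

lemma acc_step_measurable: "acc_step \<in> borel \<Otimes>\<^sub>M S \<rightarrow>\<^sub>M prob_algebra (borel \<Otimes>\<^sub>M S)"
  unfolding acc_step_def[abs_def]
  by (intro measurable_distr_prob_space2[where M=S] measurable_compose[OF measurable_snd kernel])
    measurable

sublocale acc: markov_kernel "borel \<Otimes>\<^sub>M S" acc_step
  by unfold_locales (rule acc_step_measurable)

abbreviation "acc_law \<equiv> kernel_power (borel \<Otimes>\<^sub>M S) acc_step"

lemma sets_K: "x \<in> space S \<Longrightarrow> sets (K x) = sets S"
  using measurable_space[OF kernel] by (auto simp: space_prob_algebra)

lemma space_K: "x \<in> space S \<Longrightarrow> space (K x) = space S"
  using sets_K by (rule sets_eq_imp_space_eq)

lemma prob_space_K: "x \<in> space S \<Longrightarrow> prob_space (K x)"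
  using measurable_space[OF kernel] by (auto simp: space_prob_algebra)

lemma acc_map_measurable:
  "x \<in> space S \<Longrightarrow> (\<lambda>y. (a + f y, y)) \<in> K x \<rightarrow>\<^sub>M borel \<Otimes>\<^sub>M S"
  by (subst measurable_cong_sets[OF sets_K refl]) auto

lemma acc_step_subprob_law:
  "z \<in> space (borel \<Otimes>\<^sub>M S) \<Longrightarrow> acc_step \<in> acc_law s z \<rightarrow>\<^sub>M subprob_algebra (borel \<Otimes>\<^sub>M S)"
  by (subst measurable_cong_sets[OF acc.sets_kernel_power refl])
    (auto intro: measurable_prob_algebraD acc_step_measurable)

text \<open>Every step adds a value of \<open>f\<close> in the unit interval. The lower bound keeps
  totals nonnegative inside \<open>ennreal\<close>; the upper one limits what a block can
  contribute.\<close>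

lemma acc_law_range:
  assumes z: "z \<in> space (borel \<Otimes>\<^sub>M S)"
  shows "AE w in acc_law s z. fst z \<le> fst w \<and> fst w \<le> fst z + real s"
proof (induction s)
  case 0
  show ?case unfolding kernel_power.simps by (subst AE_return[OF z]) auto
next
  case (Suc s)
  let ?P = "\<lambda>s w. fst z \<le> fst w \<and> fst w \<le> fst z + real s"
  have step: "AE v in acc_step w. ?P (Suc s) v" if w: "w \<in> space (borel \<Otimes>\<^sub>M S)" and Pw: "?P s w" for w
  proof -
    have x: "snd w \<in> space S" using w by (auto simp: space_pair_measure)
    show ?thesis unfolding acc_step_def
    proof (subst AE_distr_iff[OF acc_map_measurable[OF x]])
      show "AE y in K (snd w). ?P (Suc s) (fst w + f y, y)"
        using Pw f_range by (intro AE_I2) (force simp: space_K[OF x])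
    qed simp
  qed
  have "AE w in acc_law s z. AE v in acc_step w. ?P (Suc s) v"
    by (rule AE_mp[OF Suc], rule AE_I2, rule impI, rule step)
      (simp_all only: acc.space_kernel_power[OF z])
  then show ?case
    unfolding kernel_power.simps by (subst AE_bind[OF acc_step_subprob_law[OF z]]) simp_all
qed

lemma acc_law_AE:
  assumes z: "z \<in> space (borel \<Otimes>\<^sub>M S)"
    and "\<And>w. w \<in> space (borel \<Otimes>\<^sub>M S) \<Longrightarrow> fst z \<le> fst w \<Longrightarrow> fst w \<le> fst z + real s \<Longrightarrow> P w"
  shows "AE w in acc_law s z. P w"
  using acc_law_range[OF z, of s]
  by (rule AE_mp) (use assms acc.space_kernel_power[OF z, of s] in auto)

text \<open>One step of the martingale property. With extended nonnegative integrals the iteration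
  carries no integrability conditions, and \<open>w0\<close> keeps \<open>ennreal\<close>
  faithful.\<close>

lemma acc_step_mean:
  assumes w: "w \<in> space (borel \<Otimes>\<^sub>M S)" and w0: "0 \<le> fst w"
  shows "(\<integral>\<^sup>+v. ennreal (fst v + expected_sum m (snd v)) \<partial>acc_step w)
    = ennreal (fst w + expected_sum (Suc m) (snd w))"
proof -
  have x: "snd w \<in> space S" using w by (auto simp: space_pair_measure)
  interpret K: prob_space "K (snd w)" by (rule prob_space_K[OF x])
  have g: "(\<lambda>y. f y + expected_sum m y) \<in> borel_measurable (K (snd w))"
    by (subst measurable_cong_sets[OF sets_K[OF x] refl]) measurable
  have i: "integrable (K (snd w)) (\<lambda>y. f y + expected_sum m y)"
  proof (rule K.integrable_const_bound[where B="1 + real m", OF AE_I2 g])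
    fix y assume "y \<in> space (K (snd w))"
    then show "norm (f y + expected_sum m y) \<le> 1 + real m"
      using f_range[of y] expected_sum_bounds[of y m] by (simp add: space_K[OF x])
  qed
  have "(\<integral>\<^sup>+v. ennreal (fst v + expected_sum m (snd v)) \<partial>acc_step w)
    = (\<integral>\<^sup>+y. ennreal (fst w + (f y + expected_sum m y)) \<partial>K (snd w))"
    unfolding acc_step_def
    by (subst nn_integral_distr[OF acc_map_measurable[OF x]]) (auto simp: add.assoc)
  also have "\<dots> = ennreal (\<integral>y. fst w + (f y + expected_sum m y) \<partial>K (snd w))"
    using i w0 f_range expected_sum_bounds
    by (intro nn_integral_eq_integral AE_I2) (auto simp: space_K[OF x] add_nonneg_nonneg)
  also have "(\<integral>y. fst w + (f y + expected_sum m y) \<partial>K (snd w)) = fst w + expected_sum (Suc m) (snd w)"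
    using i by (subst Bochner_Integration.integral_add) (auto simp: K.prob_space expected_sum_Suc[OF x])
  finally show ?thesis .
qed

text \<open>Iterates the one-step property; \<open>m\<close> is arbitrary because each step removed
  from \<open>s\<close> is returned to the remaining horizon.\<close>

lemma acc_mean_nn_integral:
  assumes z: "z \<in> space (borel \<Otimes>\<^sub>M S)" and z0: "0 \<le> fst z"
  shows "(\<integral>\<^sup>+w. ennreal (fst w + expected_sum m (snd w)) \<partial>acc_law s z)
    = ennreal (fst z + expected_sum (m + s) (snd z))"
proof (induction s arbitrary: m)
  case 0
  then show ?case using z by (simp add: nn_integral_return)
next
  case (Suc s)
  have "(\<integral>\<^sup>+w. ennreal (fst w + expected_sum m (snd w)) \<partial>acc_law (Suc s) z)
    = (\<integral>\<^sup>+w. \<integral>\<^sup>+v. ennreal (fst v + expected_sum m (snd v)) \<partial>acc_step w \<partial>acc_law s z)"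
    unfolding kernel_power.simps by (rule nn_integral_bind[OF _ acc_step_subprob_law[OF z]]) measurable
  also have "\<dots> = (\<integral>\<^sup>+w. ennreal (fst w + expected_sum (Suc m) (snd w)) \<partial>acc_law s z)"
    using z0 by (intro nn_integral_cong_AE acc_law_AE[OF z] acc_step_mean) auto
  finally show ?case using Suc by simp
qed

lemma acc_mean:
  assumes z: "z \<in> space (borel \<Otimes>\<^sub>M S)" and z0: "0 \<le> fst z"
  shows "(\<integral>w. fst w + expected_sum m (snd w) \<partial>acc_law s z) = fst z + expected_sum (m + s) (snd z)"
proof -
  have x: "snd z \<in> space S" using z by (auto simp: space_pair_measure)
  have "AE w in acc_law s z. 0 \<le> fst w + expected_sum m (snd w)"
    using z0 expected_sum_bounds
    by (intro acc_law_AE[OF z] add_nonneg_nonneg) (auto simp: space_pair_measure)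
  moreover have "(\<lambda>w. fst w + expected_sum m (snd w)) \<in> borel_measurable (acc_law s z)"
    by (subst measurable_cong_sets[OF acc.sets_kernel_power[OF z] refl]) measurable
  ultimately show ?thesis
    using z0 expected_sum_bounds[OF x]
    by (subst integral_eq_nn_integral)
      (auto simp: acc_mean_nn_integral[OF z z0] simp del: ennreal_plus intro!: enn2real_ennreal)
qed

text \<open>Over one block the martingale stays in an interval whose length does not depend on
  \<open>m\<close>, so Hoeffding's lemma applies around the mean given by
  \<open>acc_mean\<close>.\<close>

lemma acc_block:
  assumes z: "z \<in> space (borel \<Otimes>\<^sub>M S)" and z0: "0 \<le> fst z" and s: "s \<le> t" and l: "0 < l"
  shows "(\<integral>\<^sup>+w. ennreal (exp (l * (fst w + expected_sum m (snd w)))) \<partial>acc_law s z)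
    \<le> ennreal (exp (l * (fst z + expected_sum (m + s) (snd z)) + l\<^sup>2 * (3 * real t)\<^sup>2 / 8))"
proof -
  have x: "snd z \<in> space S" using z by (auto simp: space_pair_measure)
  obtain a where a: "\<And>y. y \<in> space S \<Longrightarrow> a \<le> expected_sum m y \<and> expected_sum m y \<le> a + 2 * real t"
    using osc_interval[of "space S" "expected_sum m" "2 * real t"] expected_sum_osc x by blast
  let ?X = "\<lambda>w. fst w + expected_sum m (snd w)"
  let ?\<mu> = "fst z + expected_sum (m + s) (snd z)"
  have X[measurable]: "?X \<in> borel_measurable (acc_law s z)"
    by (subst measurable_cong_sets[OF acc.sets_kernel_power[OF z] refl]) measurable
  interpret prob_space "acc_law s z" by (rule acc.prob_space_kernel_power[OF z])
  \<comment> \<open>The length \<open>3 t\<close> is \<open>s \<le> t\<close> from the running total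
    plus \<open>2 t\<close> from \<open>expected_sum_osc\<close>.\<close>
  interpret X: interval_bounded_random_variable "acc_law s z" ?X "fst z + a" "fst z + a + 3 * real t"
  proof
    show "AE w in acc_law s z. ?X w \<in> {fst z + a..fst z + a + 3 * real t}"
    proof (rule acc_law_AE[OF z])
      fix w assume "w \<in> space (borel \<Otimes>\<^sub>M S)" "fst z \<le> fst w" "fst w \<le> fst z + real s"
      then show "?X w \<in> {fst z + a..fst z + a + 3 * real t}"
        using a[of "snd w"] s by (auto simp: space_pair_measure)
    qed
  qed (rule X)
  have "(\<integral>\<^sup>+w. ennreal (exp (l * ?X w)) \<partial>acc_law s z)
    = (\<integral>\<^sup>+w. ennreal (exp (l * ?\<mu>)) * ennreal (exp (l * (?X w - ?\<mu>))) \<partial>acc_law s z)"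
    by (simp flip: ennreal_mult exp_add add: algebra_simps)
  also have "\<dots> = ennreal (exp (l * ?\<mu>)) * (\<integral>\<^sup>+w. ennreal (exp (l * (?X w - ?\<mu>))) \<partial>acc_law s z)"
    by (rule nn_integral_cmult) measurable
  also have "\<dots> \<le> ennreal (exp (l * ?\<mu>)) * ennreal (exp (l\<^sup>2 * (3 * real t)\<^sup>2 / 8))"
    using X.Hoeffdings_lemma_nn_integral[OF l] by (intro mult_left_mono) (simp_all add: acc_mean[OF z z0])
  finally show ?thesis by (simp flip: ennreal_mult exp_add)
qed

text \<open>Induction on the number of blocks, each costing one Hoeffding term. The inequality
  \<open>m \<le> q * t\<close> admits incomplete blocks.\<close>

lemma acc_exp:
  assumes "z \<in> space (borel \<Otimes>\<^sub>M S)" and "0 \<le> fst z" and l: "0 < l" and "m \<le> q * t"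
  shows "(\<integral>\<^sup>+w. ennreal (exp (l * fst w)) \<partial>acc_law m z)
    \<le> ennreal (exp (l * (fst z + expected_sum m (snd z)) + real q * (l\<^sup>2 * (3 * real t)\<^sup>2 / 8)))"
  using assms(1,2,4)
proof (induction q arbitrary: m z)
  case 0
  then show ?case by (simp add: nn_integral_return expected_sum_def)
next
  case (Suc q)
  note z = Suc.prems(1) and z0 = Suc.prems(2)
  let ?c = "l\<^sup>2 * (3 * real t)\<^sup>2 / 8"
  \<comment> \<open>The first block is full if \<open>t \<le> m\<close>; otherwise it absorbs all
    steps and leaves \<open>m' = 0\<close>.\<close>
  define s where "s = min m t"
  define m' where "m' = m - s"
  have m: "m = s + m'" "s \<le> t" "m' \<le> q * t" using Suc.prems(3) by (auto simp: s_def m'_def)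
  have "(\<integral>\<^sup>+w. ennreal (exp (l * fst w)) \<partial>acc_law m z)
    = (\<integral>\<^sup>+v. \<integral>\<^sup>+w. ennreal (exp (l * fst w)) \<partial>acc_law m' v \<partial>acc_law s z)"
    unfolding m(1) by (rule acc.nn_integral_kernel_power_add[OF z]) measurable
  \<comment> \<open>Conditionally on the state \<open>v\<close> after the first block, the induction
    hypothesis bounds the rest and leaves the integrand of \<open>acc_block\<close>.\<close>
  also have "\<dots> \<le> (\<integral>\<^sup>+v. ennreal (exp (real q * ?c)) * ennreal (exp (l * (fst v + expected_sum m' (snd v)))) \<partial>acc_law s z)"
  proof (intro nn_integral_mono_AE acc_law_AE[OF z])
    fix v assume v: "v \<in> space (borel \<Otimes>\<^sub>M S)" and r: "fst z \<le> fst v"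
    show "(\<integral>\<^sup>+w. ennreal (exp (l * fst w)) \<partial>acc_law m' v)
      \<le> ennreal (exp (real q * ?c)) * ennreal (exp (l * (fst v + expected_sum m' (snd v))))"
      using Suc.IH[of v m'] v r z0 m(3)
      by (simp add: add.commute flip: ennreal_mult exp_add)
  qed
  also have "\<dots> = ennreal (exp (real q * ?c)) * (\<integral>\<^sup>+v. ennreal (exp (l * (fst v + expected_sum m' (snd v)))) \<partial>acc_law s z)"
    by (rule nn_integral_cmult, subst measurable_cong_sets[OF acc.sets_kernel_power[OF z] refl]) measurable
  also have "\<dots> \<le> ennreal (exp (real q * ?c)) * ennreal (exp (l * (fst z + expected_sum (m' + s) (snd z)) + ?c))"
    by (intro mult_left_mono acc_block z z0 m(2) l) simp
  also have "\<dots> = ennreal (exp (l * (fst z + expected_sum m (snd z)) + real (Suc q) * ?c))"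
    unfolding ennreal_mult[OF exp_ge_zero exp_ge_zero, symmetric] exp_add[symmetric]
    by (intro arg_cong[where f="\<lambda>u. ennreal (exp u)"]) (simp add: m(1) add.commute[of m'] distrib_right)
  finally show ?case .
qed

text \<open>The linear term is the effect of the starting point, from
  \<open>expected_sum_le\<close>; the quadratic term collects the Hoeffding terms of all blocks at
  parameter \<open>l / m\<close>.\<close>

lemma acc_deviation:
  assumes x: "x \<in> space S" and l: "0 < l" and tm: "t \<le> m"
  shows "(\<integral>\<^sup>+w. ennreal (exp (l * (fst w / real m - (\<integral>y. f y \<partial>Q)))) \<partial>acc_law m (0, x))
    \<le> ennreal (exp (2 * l * (real t / real m) + 9/4 * l\<^sup>2 * (real t / real m)))"
proof -
  let ?\<mu> = "\<integral>y. f y \<partial>Q"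
  have m0: "0 < real m" using tm t_ge_1 by simp
  have z: "(0, x) \<in> space (borel \<Otimes>\<^sub>M S)" using x by (simp add: space_pair_measure)
  \<comment> \<open>The extra block covers the remainder of the division. As
    \<open>t \<le> m\<close>, \<open>q * t \<le> m + t \<le> 2 * m\<close>, and
    \<open>2 * 9/8\<close> is the constant \<open>9/4\<close>.\<close>
  define q where "q = m div t + 1"
  have "m = (m div t) * t + m mod t" by simp
  moreover have "m mod t \<le> t" using mod_less_divisor[of t m] t_ge_1 by simp
  ultimately have mq: "m \<le> q * t" unfolding q_def add_mult_distrib by linarith
  have "real (m div t) * real t \<le> real m"
    using div_times_less_eq_dividend[of m t] by (metis of_nat_le_iff of_nat_mult)
  then have qt: "real q * real t \<le> 2 * real m" using tm by (simp add: q_def algebra_simps)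
  have "(\<integral>\<^sup>+w. ennreal (exp (l * (fst w / real m - ?\<mu>))) \<partial>acc_law m (0, x))
    = (\<integral>\<^sup>+w. ennreal (exp (- l * ?\<mu>)) * ennreal (exp (l / real m * fst w)) \<partial>acc_law m (0, x))"
    by (simp flip: ennreal_mult exp_add add: algebra_simps)
  also have "\<dots> = ennreal (exp (- l * ?\<mu>)) * (\<integral>\<^sup>+w. ennreal (exp (l / real m * fst w)) \<partial>acc_law m (0, x))"
    by (rule nn_integral_cmult, subst measurable_cong_sets[OF acc.sets_kernel_power[OF z] refl]) measurable
  also have "\<dots> \<le> ennreal (exp (- l * ?\<mu>)) *
      ennreal (exp (l / real m * (0 + expected_sum m x) + real q * ((l / real m)\<^sup>2 * (3 * real t)\<^sup>2 / 8)))"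
    using acc_exp[OF z _ _ mq, of "l / real m"] l m0 by (intro mult_left_mono) auto
  also have "\<dots> = ennreal (exp (l / real m * (expected_sum m x - real m * ?\<mu>) + real q * ((l / real m)\<^sup>2 * (3 * real t)\<^sup>2 / 8)))"
    using m0 by (simp flip: ennreal_mult exp_add add: algebra_simps)
  also have "\<dots> \<le> ennreal (exp (2 * l * (real t / real m) + 9/4 * l\<^sup>2 * (real t / real m)))"
  proof -
    have "l / real m * (expected_sum m x - real m * ?\<mu>) \<le> l / real m * (2 * real t)"
      using expected_sum_le[OF x, of m] l m0 by (intro mult_left_mono) auto
    moreover have "real q * ((l / real m)\<^sup>2 * (3 * real t)\<^sup>2 / 8)
      = (real q * real t) * (9/8 * (l / real m)\<^sup>2 * real t)"
      by (simp add: power2_eq_square mult_ac)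
    moreover have "\<dots> \<le> (2 * real m) * (9/8 * (l / real m)\<^sup>2 * real t)"
      by (intro mult_right_mono qt) auto
    moreover have "\<dots> = 9/4 * l\<^sup>2 * (real t / real m)"
      using m0 by (simp add: power2_eq_square field_simps)
    moreover have "l / real m * (2 * real t) = 2 * l * (real t / real m)" by simp
    ultimately show ?thesis by (intro ennreal_leI, subst exp_le_cancel_iff) linarith
  qed
  finally show ?thesis .
qed

end

section \<open>The law of the validation set\<close>

context mixing_chain
begin

lemma Q_prob_algebra: "Q \<in> space (prob_algebra S)"
  using prob_Q sets_Q by (simp add: space_prob_algebra)

sublocale path: Ionescu_Tulcea "chain_step K Q" "\<lambda>_. S"
  by (rule Ionescu_Tulcea_chain_step[OF kernel Q_prob_algebra])

text \<open>Coordinates count from 0, so the validation set occupies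
  \<open>n, ..., n + m - 1\<close>. For \<open>m = 0\<close> the last coordinate is the starting
  state, at \<open>n - 1\<close>.\<close>

lemma path_acc_measurable:
  fixes n m :: nat
  assumes "1 \<le> n"
  shows "(\<lambda>h. (\<Sum>i<m. f (h (n + i)), h (n + m - 1))) \<in> PiM {0..<n + m} (\<lambda>_. S) \<rightarrow>\<^sub>M borel \<Otimes>\<^sub>M S"
proof -
  have c: "(\<lambda>h. h j) \<in> PiM {0..<n + m} (\<lambda>_. S) \<rightarrow>\<^sub>M S" if "j < n + m" for j
    using that by (intro measurable_component_singleton) simp
  have "(\<lambda>h. \<Sum>i<m. f (h (n + i))) \<in> borel_measurable (PiM {0..<n + m} (\<lambda>_. S))"
    by (intro borel_measurable_sum measurable_compose[OF c f_measurable]) auto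
  then show ?thesis using assms by (intro measurable_Pair c) auto
qed

text \<open>Running total and last state determine the law of the next pair: extending the path and
  then projecting is the same as projecting and then taking one \<open>acc_step\<close>.\<close>

lemma distr_path_acc:
  assumes h: "h \<in> space (PiM {0..<n} (\<lambda>_. S))" and n: "1 \<le> n"
  shows "distr (path.C n m h) (borel \<Otimes>\<^sub>M S) (\<lambda>h. (\<Sum>i<m. f (h (n + i)), h (n + m - 1)))
    = acc_law m (0, h (n - 1))"
proof (induction m)
  case 0
  then show ?case using path_acc_measurable[OF n, of 0] h by (simp add: distr_return)
next
  case (Suc m)
  let ?\<phi> = "\<lambda>m h. (\<Sum>i<m. f (h (n + i)), h (n + m - 1)) :: real \<times> 'a"
  let ?P = "\<lambda>m. PiM {0..<n + m} (\<lambda>_. S)"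
  have \<phi>: "?\<phi> m \<in> ?P m \<rightarrow>\<^sub>M borel \<Otimes>\<^sub>M S" for m by (rule path_acc_measurable[OF n])
  have sC: "sets (path.C n m h) = sets (?P m)" by (rule path.sets_C[OF h])
  have spC: "space (path.C n m h) = space (?P m)" by (rule path.space_C[OF h])
  have ne: "space (path.C n m h) \<noteq> {}" by (rule prob_space.not_empty[OF path.prob_space_C[OF h]])
  have eP: "path.eP (n + m) \<in> path.C n m h \<rightarrow>\<^sub>M subprob_algebra (?P (Suc m))"
    using path.measurable_eP[of "n + m"] by (subst measurable_cong_sets[OF sC refl]) simp
  have step: "distr (path.eP (n + m) \<omega>) (borel \<Otimes>\<^sub>M S) (?\<phi> (Suc m)) = acc_step (?\<phi> m \<omega>)"
    if \<omega>: "\<omega> \<in> space (path.C n m h)" for \<omega>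
  proof -
    have \<omega>': "\<omega> \<in> space (?P m)" using \<omega> spC by simp
    then have x: "\<omega> (n + m - 1) \<in> space S" using n by (auto simp: space_PiM PiE_iff)
    \<comment> \<open>As \<open>n + m\<close> is positive, the next value is drawn from the kernel
      at the last coordinate and not from the initial law.\<close>
    have K: "chain_step K Q (n + m) \<omega> = K (\<omega> (n + m - 1))"
      using n by (cases "n + m") (auto simp: chain_step_def)
    have u: "fun_upd \<omega> (n + m) \<in> K (\<omega> (n + m - 1)) \<rightarrow>\<^sub>M ?P (Suc m)"
      using \<omega>' by (subst measurable_cong_sets[OF sets_K[OF x] refl])
        (auto intro!: measurable_fun_upd[where J="{0..<n + m}"])
    have "distr (path.eP (n + m) \<omega>) (borel \<Otimes>\<^sub>M S) (?\<phi> (Suc m))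
      = distr (K (\<omega> (n + m - 1))) (borel \<Otimes>\<^sub>M S) (?\<phi> (Suc m) \<circ> fun_upd \<omega> (n + m))"
      unfolding path.eP_def K using \<phi>[of "Suc m"] u by (subst distr_distr) auto
    also have "?\<phi> (Suc m) \<circ> fun_upd \<omega> (n + m) = (\<lambda>y. (fst (?\<phi> m \<omega>) + f y, y))"
      by (auto simp: fun_eq_iff)
    finally show ?thesis by (simp add: acc_step_def)
  qed
  have "distr (path.C n (Suc m) h) (borel \<Otimes>\<^sub>M S) (?\<phi> (Suc m))
    = path.C n m h \<bind> (\<lambda>\<omega>. distr (path.eP (n + m) \<omega>) (borel \<Otimes>\<^sub>M S) (?\<phi> (Suc m)))"
    unfolding path.C.simps by (rule distr_bind[OF eP ne \<phi>])
  also have "\<dots> = path.C n m h \<bind> (\<lambda>\<omega>. acc_step (?\<phi> m \<omega>))"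
    by (intro bind_cong refl step)
  also have "\<dots> = distr (path.C n m h) (borel \<Otimes>\<^sub>M S) (?\<phi> m) \<bind> acc_step"
  proof (rule bind_distr[symmetric, OF _ measurable_prob_algebraD[OF acc_step_measurable] ne])
    show "?\<phi> m \<in> path.C n m h \<rightarrow>\<^sub>M borel \<Otimes>\<^sub>M S"
      using \<phi>[of m] by (subst measurable_cong_sets[OF sC refl])
  qed
  finally show ?case using Suc by simp
qed

lemma validation_deviation:
  assumes x: "\<And>i. x i \<in> space S" and n: "1 \<le> n" and l: "0 < l" and tm: "t \<le> m"
  shows "(\<integral>\<^sup>+v. ennreal (exp (l * ((\<Sum>j=n+1..n+m. f (v j)) / real m - (\<integral>y. f y \<partial>Q))))
      \<partial>validation_law S K Q n m x)
    \<le> ennreal (exp (2 * l * (real t / real m) + 9/4 * l\<^sup>2 * (real t / real m)))"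
proof -
  let ?h = "\<lambda>i\<in>{0..<n}. x (Suc i)"
  let ?r = "\<lambda>h. \<lambda>j\<in>{n+1..n+m}. h (j - 1)"
  let ?\<phi> = "\<lambda>h. (\<Sum>i<m. f (h (n + i)), h (n + m - 1))"
  let ?e = "\<lambda>s. ennreal (exp (l * (s / real m - (\<integral>y. f y \<partial>Q))))"
  have h: "?h \<in> space (PiM {0..<n} (\<lambda>_. S))" using x by (auto simp: space_PiM)
  have sC: "sets (path.C n m ?h) = sets (PiM {0..<n + m} (\<lambda>_. S))" by (rule path.sets_C[OF h])
  have r: "?r \<in> path.C n m ?h \<rightarrow>\<^sub>M PiM {n+1..n+m} (\<lambda>_. S)"
    by (subst measurable_cong_sets[OF sC refl], rule measurable_restrict,
      rule measurable_component_singleton) auto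
  have m1: "(\<lambda>v. \<Sum>j=n+1..n+m. f (v j)) \<in> borel_measurable (PiM {n+1..n+m} (\<lambda>_. S))"
    by (intro borel_measurable_sum measurable_compose[OF _ f_measurable] measurable_component_singleton)
  have \<phi>: "?\<phi> \<in> path.C n m ?h \<rightarrow>\<^sub>M borel \<Otimes>\<^sub>M S"
    by (subst measurable_cong_sets[OF sC refl]) (rule path_acc_measurable[OF n])
  \<comment> \<open>The index \<open>j = n + i + 1\<close> of the validation set sits at coordinate
    \<open>n + i\<close>.\<close>
  have shift: "(\<Sum>j=n+1..n+m. f (?r h j)) = (\<Sum>i<m. f (h (n + i)))" for h
    by (rule sum.reindex_bij_witness[of _ "\<lambda>i. n + i + 1" "\<lambda>j. j - n - 1"]) auto
  have "(\<integral>\<^sup>+v. ?e (\<Sum>j=n+1..n+m. f (v j)) \<partial>validation_law S K Q n m x)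
    = (\<integral>\<^sup>+h. ?e (\<Sum>j=n+1..n+m. f (?r h j)) \<partial>path.C n m ?h)"
    unfolding validation_law_def using m1 by (intro nn_integral_distr[OF r]) measurable
  also have "\<dots> = (\<integral>\<^sup>+h. ?e (fst (?\<phi> h)) \<partial>path.C n m ?h)"
    unfolding shift by simp
  also have "\<dots> = (\<integral>\<^sup>+w. ?e (fst w) \<partial>distr (path.C n m ?h) (borel \<Otimes>\<^sub>M S) ?\<phi>)"
    by (rule nn_integral_distr[symmetric, OF \<phi>]) measurable
  \<comment> \<open>The last coordinate of \<open>?h\<close> is \<open>n - 1\<close>, which holds
    \<open>x n\<close>: the chain starts from the last learning observation with total 0.\<close>
  also have "\<dots> = (\<integral>\<^sup>+w. ?e (fst w) \<partial>acc_law m (0, x n))"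
    unfolding distr_path_acc[OF h n] using n by simp
  also have "\<dots> \<le> ennreal (exp (2 * l * (real t / real m) + 9/4 * l\<^sup>2 * (real t / real m)))"
    by (rule acc_deviation[OF x l tm])
  finally show ?thesis .
qed

end

section \<open>Maxima of families with controlled exponential moments\<close>

lemma (in prob_space) prob_gt_le_exp:
  assumes X[measurable]: "random_variable borel X" and l: "0 < l"
    and B: "(\<integral>\<^sup>+x. ennreal (exp (l * X x)) \<partial>M) \<le> ennreal B" and "0 \<le> B"
  shows "\<P>(x in M. X x > a) \<le> exp (- l * a) * B"
proof -
  have "emeasure M {x\<in>space M. X x > a} = (\<integral>\<^sup>+x. indicator {x\<in>space M. X x > a} x \<partial>M)"
    by (simp add: nn_integral_indicator)
  also have "\<dots> \<le> (\<integral>\<^sup>+x. ennreal (exp (- l * a)) * ennreal (exp (l * X x)) \<partial>M)"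
  proof (rule nn_integral_mono)
    fix x
    \<comment> \<open>The indicator of the event is dominated by
      \<open>exp (l * (X x - a))\<close>.\<close>
    have "1 \<le> exp (- l * a + l * X x)" if "X x > a"
      using that l by (simp add: one_le_exp_iff)
    then show "indicator {x\<in>space M. X x > a} x \<le> ennreal (exp (- l * a)) * ennreal (exp (l * X x))"
      by (auto simp: indicator_def simp flip: ennreal_mult exp_add)
  qed
  also have "\<dots> = ennreal (exp (- l * a)) * (\<integral>\<^sup>+x. ennreal (exp (l * X x)) \<partial>M)"
    by (rule nn_integral_cmult) measurable
  also have "\<dots> \<le> ennreal (exp (- l * a)) * ennreal B"
    by (intro mult_left_mono B) auto
  also have "\<dots> = ennreal (exp (- l * a) * B)" using \<open>0 \<le> B\<close> by (simp add: ennreal_mult)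
  finally show ?thesis using \<open>0 \<le> B\<close> by (simp add: emeasure_eq_measure)
qed

text \<open>\<open>\<tau>\<close> stands for the mixing time divided by the size of the validation
  set. The linear term of the exponent is a bias, the quadratic one a variance proxy.\<close>

locale deviation_family = prob_space +
  fixes D :: "'i \<Rightarrow> 'a \<Rightarrow> real" and I :: "'i set" and \<tau> :: real
  assumes finite_I: "finite I" and I_nonempty: "I \<noteq> {}"
    and D_measurable [measurable]: "\<And>i. i \<in> I \<Longrightarrow> random_variable borel (D i)"
    and \<tau>_pos: "0 < \<tau>"
    and mgf: "\<And>i l. i \<in> I \<Longrightarrow> 0 < l \<Longrightarrow>
      (\<integral>\<^sup>+x. ennreal (exp (l * D i x)) \<partial>M) \<le> ennreal (exp (2 * l * \<tau> + 9/4 * l\<^sup>2 * \<tau>))"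
begin

text \<open>The dominating index may vary with the outcome, so the event is covered by the union
  over all of \<open>I\<close>, at the price of the factor \<open>card I\<close>.\<close>

lemma prob_selected_gt:
  assumes W: "\<And>x. x \<in> space M \<Longrightarrow> \<exists>i\<in>I. W x \<le> D i x"
    and e: "0 \<le> e" "e \<le> 1"
  shows "\<P>(x in M. W x > e) \<le> real (card I) * (3 * exp (- (e\<^sup>2 / (9 * \<tau>))))"
proof -
  have single: "\<P>(x in M. D i x > e) \<le> 3 * exp (- (e\<^sup>2 / (9 * \<tau>)))" if i: "i \<in> I" for i
  \<comment> \<open>At \<open>e = 0\<close> the parameter chosen below would be 0, but the bound is
    then 3.\<close>
  proof (cases "e = 0")
    case True
    then show ?thesis using prob_le_1[of "{x\<in>space M. D i x > e}"] by (simp del: prob_le_1)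
  next
    case False
    \<comment> \<open>The minimiser of \<open>9/4 * l^2 * \<tau> - l * e\<close>, with minimum
      \<open>- e^2 / (9 * \<tau>)\<close>.\<close>
    define l where "l = 2 * e / (9 * \<tau>)"
    have l: "0 < l" using False e \<tau>_pos by (simp add: l_def)
    have "\<P>(x in M. D i x > e) \<le> exp (- l * e) * exp (2 * l * \<tau> + 9/4 * l\<^sup>2 * \<tau>)"
      by (rule prob_gt_le_exp[OF D_measurable[OF i] l mgf[OF i l]]) simp
    also have "\<dots> = exp (4/9 * e - e\<^sup>2 / (9 * \<tau>))"
      using \<tau>_pos by (simp add: l_def power2_eq_square field_simps flip: exp_add)
    \<comment> \<open>The bias contributes \<open>4/9 * e\<close>, which is at most 1 because
      \<open>e \<le> 1\<close>; it is paid for by the factor \<open>exp 1 \<le> 3\<close>.\<close>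
    also have "\<dots> \<le> exp (1 - e\<^sup>2 / (9 * \<tau>))" using e by simp
    also have "\<dots> = exp 1 * exp (- (e\<^sup>2 / (9 * \<tau>)))" by (simp flip: exp_add)
    also have "\<dots> \<le> 3 * exp (- (e\<^sup>2 / (9 * \<tau>)))" using exp_le by (intro mult_right_mono) auto
    finally show ?thesis .
  qed
  have "\<P>(x in M. W x > e) \<le> measure M (\<Union>i\<in>I. {x\<in>space M. D i x > e})"
    using W finite_I by (intro finite_measure_mono sets.finite_UN) (force, measurable)
  also have "\<dots> \<le> (\<Sum>i\<in>I. \<P>(x in M. D i x > e))"
    using finite_I by (intro finite_measure_subadditive_finite) (auto intro: D_measurable)
  also have "\<dots> \<le> (\<Sum>i\<in>I. 3 * exp (- (e\<^sup>2 / (9 * \<tau>))))" by (intro sum_mono single)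
  finally show ?thesis by simp
qed

text \<open>The maximal inequality \<open>exp (l * E W) \<le> E (exp (l * W)) \<le> (\<Sum>i\<in>I. E (exp (l * D i)))\<close>,
  with \<open>l\<close> of the order of the optimal one.\<close>

lemma expectation_selected_le:
  assumes W: "\<And>x. x \<in> space M \<Longrightarrow> \<exists>i\<in>I. W x \<le> D i x"
    and W1: "\<And>x. x \<in> space M \<Longrightarrow> \<bar>W x\<bar> \<le> 1"
  shows "expectation W \<le> sqrt (10 * \<tau> * (ln (real (card I)) + 2))"
proof (cases "integrable M W")
  \<comment> \<open>The integral is 0 by convention here, and the right-hand side is
    nonnegative.\<close>
  case False
  have "1 \<le> card I" using finite_I I_nonempty by (simp add: Suc_leI card_gt_0_iff)
  then show ?thesis using False \<tau>_pos by (simp add: not_integrable_integral_eq)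
next
  case True
  then have [measurable]: "W \<in> borel_measurable M" by simp
  define N where "N = real (card I)"
  have N: "1 \<le> N" using finite_I I_nonempty by (simp add: N_def Suc_leI card_gt_0_iff)
  \<comment> \<open>\<open>mean_rate\<close> provides the summand 2: one unit from the factor
    \<open>exp 1\<close> in the logarithm, one from a prefactor of at least 3.\<close>
  define L where "L = ln N + 2"
  have L: "2 \<le> L" using N by (simp add: L_def)
  define T where "T = sqrt (10 * \<tau> * L)"
  have T2: "T\<^sup>2 = 10 * \<tau> * L" and T0: "0 < T" using L \<tau>_pos by (simp_all add: T_def)
  define \<mu> where "\<mu> = expectation W"
  have "\<mu> \<le> 1" unfolding \<mu>_def using W1 by (intro integral_le_const True AE_I2) (simp add: abs_le_iff)
  show ?thesis
  proof (cases "1 \<le> T")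
    case True
    then have "\<mu> \<le> T" using \<open>\<mu> \<le> 1\<close> by simp
    then show ?thesis by (simp add: \<mu>_def T_def L_def N_def)
  next
    case False
    \<comment> \<open>Minimising \<open>L / l + 9/4 * l * \<tau>\<close> would give
      \<open>2/3 * sqrt (L / \<tau>)\<close>; this choice is
      \<open>2 / sqrt 10 * sqrt (L / \<tau>)\<close> and makes \<open>l * T = 2 * L\<close>.\<close>
    define l where "l = 2 * L / T"
    have l: "0 < l" using L T0 by (simp add: l_def)
    have i: "integrable M (\<lambda>x. exp (l * W x))"
    proof (rule integrable_const_bound[where B="exp l"])
      show "AE x in M. norm (exp (l * W x)) \<le> exp l"
        using W1 l by (intro AE_I2) (simp add: abs_le_iff)
    qed measurable
    \<comment> \<open>Jensen's inequality through the tangent of the exponential at the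
      mean.\<close>
    have "exp (l * \<mu>) = (\<integral>x. exp (l * \<mu>) * (1 + l * (W x - \<mu>)) \<partial>M)"
      using True by (simp add: prob_space \<mu>_def)
    also have "\<dots> \<le> (\<integral>x. exp (l * W x) \<partial>M)"
    proof (rule integral_mono[OF _ i])
      fix x
      have "exp (l * \<mu>) * (1 + l * (W x - \<mu>)) \<le> exp (l * \<mu>) * exp (l * (W x - \<mu>))"
        by (intro mult_left_mono exp_ge_add_one_self) auto
      then show "exp (l * \<mu>) * (1 + l * (W x - \<mu>)) \<le> exp (l * W x)"
        by (simp add: algebra_simps flip: exp_add)
    qed (use True in simp)
    finally have "ennreal (exp (l * \<mu>)) \<le> (\<integral>\<^sup>+x. ennreal (exp (l * W x)) \<partial>M)"
      using i by (subst nn_integral_eq_integral) (auto intro: ennreal_leI)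
    also have "\<dots> \<le> (\<integral>\<^sup>+x. (\<Sum>i\<in>I. ennreal (exp (l * D i x))) \<partial>M)"
    proof (rule nn_integral_mono)
      fix x assume "x \<in> space M"
      then obtain i where i: "i \<in> I" "W x \<le> D i x" using W by blast
      then have "ennreal (exp (l * W x)) \<le> ennreal (exp (l * D i x))"
        using l by (intro ennreal_leI) simp
      also have "\<dots> \<le> (\<Sum>i\<in>I. ennreal (exp (l * D i x)))"
        using i finite_I by (intro member_le_sum) auto
      finally show "ennreal (exp (l * W x)) \<le> (\<Sum>i\<in>I. ennreal (exp (l * D i x)))" .
    qed
    also have "\<dots> = (\<Sum>i\<in>I. \<integral>\<^sup>+x. ennreal (exp (l * D i x)) \<partial>M)"
      by (intro nn_integral_sum) (simp add: D_measurable)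
    also have "\<dots> \<le> (\<Sum>i\<in>I. ennreal (exp (2 * l * \<tau> + 9/4 * l\<^sup>2 * \<tau>)))"
      by (intro sum_mono mgf l)
    also have "\<dots> = ennreal (N * exp (2 * l * \<tau> + 9/4 * l\<^sup>2 * \<tau>))"
      by (simp add: N_def ennreal_mult ennreal_of_nat_eq_real_of_nat)
    also have "N * exp (2 * l * \<tau> + 9/4 * l\<^sup>2 * \<tau>) = exp (L - 2 + 2 * l * \<tau> + 9/4 * l\<^sup>2 * \<tau>)"
      using N by (simp add: L_def exp_add)
    finally have "l * \<mu> \<le> L - 2 + 2 * l * \<tau> + 9/4 * l\<^sup>2 * \<tau>" by simp
    \<comment> \<open>The left side is \<open>19/10 * L - 2 + 2/5 * T\<close>; since
      \<open>T < 1\<close>, the term \<open>- 2\<close> absorbs the bias.\<close>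
    also have "\<dots> \<le> l * T"
    proof -
      have "l * \<tau> = T / 5" using T2 L T0 \<tau>_pos by (simp add: l_def field_simps power2_eq_square)
      moreover have "l\<^sup>2 * \<tau> = 2 * L / 5"
        using T2 T0 L \<tau>_pos by (simp add: l_def field_simps power2_eq_square)
      moreover have "l * T = 2 * L" using T0 by (simp add: l_def)
      ultimately show ?thesis using False L by simp
    qed
    finally have "\<mu> \<le> T" using l by simp
    then show ?thesis by (simp add: \<mu>_def T_def L_def N_def)
  qed
qed

end

section \<open>From uniform ergodicity and abstract deviations to the stated rates\<close>

section \<open>Risk bounds\<close>

text \<open>The geometric rate makes the set of admissible times nonempty, so the
  \<open>LEAST\<close> in \<open>mixing_time\<close> is attained; it also yields the convergence of
  the powers.\<close>

lemma mixing_chainI: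
  assumes K: "K \<in> S \<rightarrow>\<^sub>M prob_algebra S" and Q: "prob_space Q" and sQ: "sets Q = sets S"
    and erg: "uniformly_ergodic S K Q"
    and f: "f \<in> borel_measurable S" "\<And>x. x \<in> space S \<Longrightarrow> 0 \<le> f x \<and> f x \<le> 1"
  shows "mixing_chain S K Q (mixing_time S K Q) f"
proof -
  interpret markov_kernel S K by unfold_locales (rule K)
  obtain C \<rho> where C: "0 < C" "0 < \<rho>" "\<rho> < 1" "\<And>n. max_tv_dist S K Q n \<le> C * \<rho> ^ n"
    using erg unfolding uniformly_ergodic_def by blast
  \<comment> \<open>Distances are at most 1, so the real supremum is a genuine upper bound.\<close>
  have le_max: "tv_dist (kernel_power S K n x) Q \<le> max_tv_dist S K Q n" if "x \<in> space S" for n x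
    unfolding max_tv_dist_def
    by (rule cSUP_upper[OF that], rule bdd_aboveI2[where M=1], rule tv_dist_le_1)
      (auto intro: prob_space_kernel_power Q)
  have nonneg: "0 \<le> tv_dist (kernel_power S K n x) Q" if "x \<in> space S" for n x
    using tv_dist_ge_measure[OF prob_space_kernel_power[OF that] Q, of "{}"] by simp
  have "(\<lambda>n. C * \<rho> ^ n) \<longlonglongrightarrow> C * 0"
    using C by (intro tendsto_intros LIMSEQ_power_zero) auto
  then have lim: "(\<lambda>n. C * \<rho> ^ n) \<longlonglongrightarrow> 0" by simp
  then have "eventually (\<lambda>n. C * \<rho> ^ n < 1/4) sequentially"
    by (rule order_tendstoD) simp
  then obtain n0 where "\<And>n. n \<ge> n0 \<Longrightarrow> C * \<rho> ^ n < 1/4"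
    unfolding eventually_sequentially by blast
  \<comment> \<open>\<open>Suc n0\<close> instead of \<open>n0\<close> ensures a time of at least
    1.\<close>
  then have "C * \<rho> ^ Suc n0 < 1/4" by (metis le_SucI order_refl)
  then have "1 \<le> Suc n0 \<and> max_tv_dist S K Q (Suc n0) \<le> 1/4"
    using C(4)[of "Suc n0"] by linarith
  then have mix: "1 \<le> mixing_time S K Q \<and> max_tv_dist S K Q (mixing_time S K Q) \<le> 1/4"
    unfolding mixing_time_def by (rule LeastI)
  show ?thesis
  proof (intro mixing_chain.intro mixing_chain_axioms.intro)
    show "tv_dist (kernel_power S K (mixing_time S K Q) x) Q \<le> 1/4" if "x \<in> space S" for x
      using le_max[OF that] mix by (meson order_trans)
    show "(\<lambda>n. tv_dist (kernel_power S K n x) Q) \<longlonglongrightarrow> 0" if "x \<in> space S" for x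
      using nonneg[OF that] order_trans[OF le_max[OF that] C(4)]
      by (intro tendsto_sandwich[OF _ _ tendsto_const lim] always_eventually allI)
  qed (fact markov_kernel_axioms Q sQ conjunct1[OF mix] f)+
qed

lemma (in mixing_chain) prob_space_validation_law:
  assumes "\<And>i. x i \<in> space S"
  shows "prob_space (validation_law S K Q n m x)"
  unfolding validation_law_def
proof (rule prob_space.prob_space_distr)
  have h: "(\<lambda>i\<in>{0..<n}. x (Suc i)) \<in> space (PiM {0..<n} (\<lambda>_. S))"
    using assms by (auto simp: space_PiM)
  show "prob_space (path.C n m (\<lambda>i\<in>{0..<n}. x (Suc i)))" by (rule path.prob_space_C[OF h])
  show "(\<lambda>h. \<lambda>j\<in>{n+1..n+m}. h (j - 1))
    \<in> path.C n m (\<lambda>i\<in>{0..<n}. x (Suc i)) \<rightarrow>\<^sub>M PiM {n+1..n+m} (\<lambda>_. S)"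
    by (subst measurable_cong_sets[OF path.sets_C[OF h] refl], rule measurable_restrict,
      rule measurable_component_singleton) auto
qed

text \<open>The constants 3 and \<open>1/9\<close> obtained above are sharper than those of the
  goal: \<open>ln 2 / (1 + 9 * ln 2) \<le> 1/9\<close> and \<open>exp (ln 2 / t) \<ge> 1\<close>.
  The second claim makes the goal trivial for validation sets shorter than the mixing time.\<close>

lemma tail_rate:
  fixes t m e N :: real
  assumes "1 \<le> N" "1 \<le> t" "0 < m" "0 \<le> e" "e \<le> 1"
  defines "R \<equiv> N * (2 * exp (ln 2 / t) + 1) * exp (- (m * e\<^sup>2 * ln 2 / ((1 + 9 * ln 2) * t)))"
  shows "N * (3 * exp (- (e\<^sup>2 / (9 * (t / m))))) \<le> R" and "m < t \<Longrightarrow> 1 \<le> R"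
proof -
  have ln2: "0 < ln (2::real)" by simp
  have A: "3 \<le> 2 * exp (ln 2 / t) + 1" using assms ln2 by (simp add: one_le_exp_iff)
  have "ln 2 / (1 + 9 * ln 2) \<le> (1/9::real)"
    using ln2 by (subst pos_divide_le_eq) (auto intro: add_pos_pos)
  then have "ln 2 / (1 + 9 * ln 2) * (e\<^sup>2 * m / t) \<le> (1/9) * (e\<^sup>2 * m / t)"
    using assms by (intro mult_right_mono) auto
  then have x: "m * e\<^sup>2 * ln 2 / ((1 + 9 * ln 2) * t) \<le> e\<^sup>2 / (9 * (t / m))"
    by (simp add: mult_ac)
  have N3: "N * 3 \<le> N * (2 * exp (ln 2 / t) + 1)"
    using A assms by (intro mult_left_mono) auto
  have "(N * 3) * exp (- (e\<^sup>2 / (9 * (t / m)))) \<le> R"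
    unfolding R_def using x N3 assms by (intro mult_mono) auto
  then show first: "N * (3 * exp (- (e\<^sup>2 / (9 * (t / m))))) \<le> R" by (simp add: mult.assoc)
  assume mt: "m < t"
  have "e\<^sup>2 * m \<le> 1 * t" using assms mt by (intro mult_mono) (auto simp: power_le_one)
  then have "e\<^sup>2 / (9 * (t / m)) \<le> 1/9" using assms by (simp add: divide_simps)
  \<comment> \<open>From \<open>1 + u \<le> exp u\<close>; the factor 3 lifts \<open>8/9\<close>
    above 1.\<close>
  then have "8/9 \<le> exp (- (e\<^sup>2 / (9 * (t / m))))"
    using exp_ge_add_one_self[of "- (e\<^sup>2 / (9 * (t / m)))"] by linarith
  then have "1 * 1 \<le> N * (3 * exp (- (e\<^sup>2 / (9 * (t / m)))))"
    using assms by (intro mult_mono) auto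
  then show "1 \<le> R" using first by simp
qed

text \<open>\<open>(1 + 9 * ln 2) / ln 2 = 9 + 1 / ln 2\<close> is at least 10 because
  \<open>ln 2 \<le> 1\<close>, and the logarithm is at least \<open>ln N + 2\<close> because the
  prefactor is at least \<open>exp 1\<close>.\<close>

lemma mean_rate:
  fixes t m N :: real
  assumes "1 \<le> N" "1 \<le> t" "0 < m"
  defines "R \<equiv> sqrt (ln (exp 1 * N * (2 * exp (ln 2 / t) + 1)) * (1 + 9 * ln 2) * t / (m * ln 2))"
  shows "sqrt (10 * (t / m) * (ln N + 2)) \<le> R" and "m < t \<Longrightarrow> 1 \<le> R"
proof -
  have ln2: "0 < ln (2::real)" "ln (2::real) \<le> 1" using ln_le_minus_one[of "2::real"] by auto
  define A where "A = 2 * exp (ln 2 / t) + 1"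
  have A: "3 \<le> A" using assms ln2 by (simp add: A_def one_le_exp_iff)
  have "exp 1 \<le> A" using A exp_le by linarith
  then have "1 \<le> ln A" using A by (simp add: ln_ge_iff)
  moreover have "ln (exp 1 * N * A) = 1 + ln N + ln A" using assms A by (simp add: ln_mult)
  ultimately have l: "ln N + 2 \<le> ln (exp 1 * N * A)" by simp
  have ten: "10 \<le> (1 + 9 * ln 2) / ln (2::real)" using ln2 by (subst pos_le_divide_eq) auto
  then have "10 * (t / m) \<le> (1 + 9 * ln 2) / ln 2 * (t / m)"
    using assms by (intro mult_right_mono) auto
  then have "10 * (t / m) * (ln N + 2) \<le> (1 + 9 * ln 2) / ln 2 * (t / m) * ln (exp 1 * N * A)"
    using l assms ten by (intro mult_mono mult_nonneg_nonneg) simp_all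
  then show first: "sqrt (10 * (t / m) * (ln N + 2)) \<le> R"
    unfolding R_def A_def[symmetric] by (simp add: mult_ac)
  assume "m < t"
  then have "1 * 1 \<le> (10 * (t / m)) * (ln N + 2)"
    using assms by (intro mult_mono) (auto simp: divide_simps)
  then have "1 \<le> sqrt (10 * (t / m) * (ln N + 2))" by (subst real_sqrt_ge_1_iff) simp
  then show "1 \<le> R" using first by (rule order_trans)
qed

text \<open>For \<open>t \<le> m\<close> this is \<open>deviation_family\<close> with
  \<open>t / m\<close> for \<open>\<tau>\<close>; for \<open>m < t\<close> both right-hand sides are
  at least 1.\<close>

lemma (in prob_space) selected_deviation:
  fixes W :: "'a \<Rightarrow> real" and D :: "nat \<Rightarrow> 'a \<Rightarrow> real" and t m N :: nat
  assumes N: "1 \<le> N" and t: "1 \<le> t" and m: "1 \<le> m"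
    and D[measurable]: "\<And>k. k \<in> {1..N} \<Longrightarrow> random_variable borel (D k)"
    and mgf: "\<And>k l. k \<in> {1..N} \<Longrightarrow> 0 < l \<Longrightarrow> t \<le> m \<Longrightarrow> (\<integral>\<^sup>+x. ennreal (exp (l * D k x)) \<partial>M)
      \<le> ennreal (exp (2 * l * (real t / real m) + 9/4 * l\<^sup>2 * (real t / real m)))"
    and W: "\<And>x. x \<in> space M \<Longrightarrow> \<exists>k\<in>{1..N}. W x \<le> D k x"
    and W1: "\<And>x. x \<in> space M \<Longrightarrow> \<bar>W x\<bar> \<le> 1"
  shows "0 \<le> \<epsilon> \<Longrightarrow> \<epsilon> \<le> 1 \<Longrightarrow> \<P>(x in M. W x > \<epsilon>) \<le> real N * (2 * exp (ln 2 / real t) + 1)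
      * exp (- (real m * \<epsilon>\<^sup>2 * ln 2 / ((1 + 9 * ln 2) * real t)))"
    and "expectation W \<le> sqrt (ln (exp 1 * real N * (2 * exp (ln 2 / real t) + 1)) * (1 + 9 * ln 2) * real t
      / (real m * ln 2))"
proof -
  have r: "1 \<le> real N" "1 \<le> real t" "0 < real m" using N t m by auto
  have fam: "deviation_family M D {1..N} (real t / real m)" if "t \<le> m"
    by unfold_locales (use N t m mgf[OF _ _ that] in auto)
  show "\<P>(x in M. W x > \<epsilon>) \<le> real N * (2 * exp (ln 2 / real t) + 1)
      * exp (- (real m * \<epsilon>\<^sup>2 * ln 2 / ((1 + 9 * ln 2) * real t)))" if e: "0 \<le> \<epsilon>" "\<epsilon> \<le> 1"
  proof (cases "t \<le> m")
    case True
    interpret deviation_family M D "{1..N}" "real t / real m" by (rule fam[OF True])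
    show ?thesis using prob_selected_gt[OF W e] tail_rate(1)[OF r e] by simp
  next
    case False
    then show ?thesis using tail_rate(2)[OF r e] by (intro order_trans[OF prob_le_1]) simp
  qed
  show "expectation W \<le> sqrt (ln (exp 1 * real N * (2 * exp (ln 2 / real t) + 1)) * (1 + 9 * ln 2) * real t
      / (real m * ln 2))"
  proof (cases "t \<le> m")
    case True
    interpret deviation_family M D "{1..N}" "real t / real m" by (rule fam[OF True])
    show ?thesis by (rule order_trans[OF _ mean_rate(1)[OF r]])
      (use expectation_selected_le[OF W W1] in simp)
  next
    case False
    have "expectation W \<le> 1"
    proof (cases "integrable M W")
      case True
      then show ?thesis using W1 by (intro integral_le_const AE_I2) (auto simp: abs_le_iff)
    qed (simp add: not_integrable_integral_eq)
    then show ?thesis by (rule order_trans[OF _ mean_rate(2)[OF r]]) (use False in simp)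
  qed
qed

section \<open>Losses of the predictors and the four bounds\<close>

lemma loss_at_measurable:
  fixes g :: "(nat \<Rightarrow> 'y::polish_space) \<Rightarrow> 'y"
  assumes "loss_function L" "g \<in> predictors p"
  shows "loss_at p L g \<in> borel_measurable (vecs (p + 1))"
proof -
  have L: "L \<in> borel_measurable (borel :: ('y \<times> 'y) measure)" and g: "g \<in> vecs p \<rightarrow>\<^sub>M borel"
    using assms by (auto simp: loss_function_def predictors_def)
  have 1: "(\<lambda>x. \<lambda>i\<in>{..<p}. x (Suc i)) \<in> vecs (p + 1) \<rightarrow>\<^sub>M (vecs p :: (nat \<Rightarrow> 'y) measure)"
    by (intro measurable_restrict measurable_component_singleton) auto
  have 2: "(\<lambda>x. x 0) \<in> vecs (p + 1) \<rightarrow>\<^sub>M (borel :: 'y measure)"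
    by (intro measurable_component_singleton) auto
  show ?thesis unfolding loss_at_def[abs_def]
    by (rule measurable_compose[OF borel_measurable_Pair[OF measurable_compose[OF 1 g] 2] L])
qed

lemma loss_at_range: "loss_function L \<Longrightarrow> 0 \<le> loss_at p L g x \<and> loss_at p L g x \<le> 1"
  unfolding loss_function_def loss_at_def
  by (meson atLeastAtMost_iff range_subsetD)

theorem theorem3p2:
  fixes M :: "'w measure" and Y :: "int \<Rightarrow> 'w \<Rightarrow> 'y::polish_space"
    and \<kappa> :: "(nat \<Rightarrow> 'y) \<Rightarrow> 'y measure"
    and k0 p n m N k_tilde :: nat
    and L L_tilde :: "'y \<times> 'y \<Rightarrow> real"
    and G :: "nat \<Rightarrow> ((nat \<Rightarrow> 'y) \<Rightarrow> 'y) set" and g_hat :: "nat \<Rightarrow> (nat \<Rightarrow> 'y) \<Rightarrow> 'y"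
    and y :: "int \<Rightarrow> 'y" and k_hat :: "(nat \<Rightarrow> nat \<Rightarrow> 'y) \<Rightarrow> nat"
  defines "S \<equiv> vecs (p + 1)"
    and "K \<equiv> window_kernel k0 \<kappa> (p + 1)"
    and "Q \<equiv> window_law (p + 1) M Y"
    and "x \<equiv> (\<lambda>t. window (p + 1) y (int t))"
  defines "t_mix \<equiv> real (mixing_time S K Q)"
    and "V \<equiv> validation_law S K Q n m x"
    and "risk \<equiv> expected_loss p L Q"
    and "emp \<equiv> empirical_loss p L n m"
  assumes "markov_chain_of_order k0 \<kappa> M Y"
    and "stationary M Y"
    and "k0 \<le> p"
    and "uniformly_ergodic S K Q"
    and "loss_function L" and "loss_function L_tilde"
    and "1 \<le> N" and "1 \<le> n" and "1 \<le> m"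
    and "\<And>k. k \<in> {1..N} \<Longrightarrow> G k \<subseteq> predictors p"
    and "\<And>k. k \<in> {1..N} \<Longrightarrow>
      is_arg_min (\<lambda>g. \<Sum>t=1..n. loss_at p L_tilde g (x t)) (\<lambda>g. g \<in> G k) (g_hat k)"
    and "is_arg_min (\<lambda>k. risk (g_hat k)) (\<lambda>k. k \<in> {1..N}) k_tilde"
    and "k_hat \<in> PiM {n+1..n+m} (\<lambda>_. S) \<rightarrow>\<^sub>M count_space UNIV"
    and "\<And>v. v \<in> space (PiM {n+1..n+m} (\<lambda>_. S)) \<Longrightarrow>
      is_arg_min (\<lambda>k. emp v (g_hat k)) (\<lambda>k. k \<in> {1..N}) (k_hat v)"
  shows "(\<forall>\<epsilon>. 0 \<le> \<epsilon> \<and> \<epsilon> \<le> 1 \<longrightarrow>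
        \<P>(v in V. risk (g_hat (k_hat v)) - emp v (g_hat (k_hat v)) > \<epsilon>)
          \<le> real N * (2 * exp (ln 2 / t_mix) + 1)
              * exp (- (real m * \<epsilon>\<^sup>2 * ln 2 / ((1 + 9 * ln 2) * t_mix)))
      \<and> \<P>(v in V. emp v (g_hat k_tilde) - risk (g_hat k_tilde) > \<epsilon>)
          \<le> real N * (2 * exp (ln 2 / t_mix) + 1)
              * exp (- (real m * \<epsilon>\<^sup>2 * ln 2 / ((1 + 9 * ln 2) * t_mix))))
    \<and> (\<integral>v. risk (g_hat (k_hat v)) - emp v (g_hat (k_hat v)) \<partial>V)
        \<le> sqrt (ln (exp 1 * real N * (2 * exp (ln 2 / t_mix) + 1)) * (1 + 9 * ln 2) * t_mix
                 / (real m * ln 2))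
    \<and> (\<integral>v. emp v (g_hat k_tilde) - risk (g_hat k_tilde) \<partial>V)
        \<le> sqrt (ln (exp 1 * real N * (2 * exp (ln 2 / t_mix) + 1)) * (1 + 9 * ln 2) * t_mix
                 / (real m * ln 2))"
proof -
  note chain = assms(9)[unfolded markov_chain_of_order_def]
  have K: "K \<in> S \<rightarrow>\<^sub>M prob_algebra S"
    unfolding S_def K_def using chain assms(11) by (intro window_kernel_measurable) auto
  have Y: "Y s \<in> M \<rightarrow>\<^sub>M borel" for s using chain by blast
  have w: "(\<lambda>\<omega>. window (p + 1) (\<lambda>s. Y s \<omega>) 0) \<in> M \<rightarrow>\<^sub>M S"
    unfolding window_def S_def by (intro measurable_restrict Y)
  have Q: "prob_space Q" and sQ: "sets Q = sets S"
    using chain w by (auto simp: Q_def window_law_def S_def intro!: prob_space.prob_space_distr)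
  have x: "x i \<in> space S" for i by (auto simp: x_def S_def window_def space_PiM)
  have g: "g_hat k \<in> predictors p" if "k \<in> {1..N}" for k
    using assms(18)[OF that] assms(19)[OF that] by (auto simp: is_arg_min_def)
  have meas: "loss_at p L (g_hat k) \<in> borel_measurable S" if "k \<in> {1..N}" for k
    unfolding S_def by (rule loss_at_measurable[OF assms(13) g[OF that]])
  note range = loss_at_range[OF assms(13)]
  let ?f = "\<lambda>k. loss_at p L (g_hat k)" and ?t = "mixing_time S K Q"
  have pos: "mixing_chain S K Q ?t (?f k)" if "k \<in> {1..N}" for k
    by (rule mixing_chainI[OF K Q sQ assms(12) meas[OF that] range])
  \<comment> \<open>Upward deviations of \<open>1 - ?f k\<close> are downward deviations of
    \<open>?f k\<close>, which gives the sign risk minus empirical loss.\<close>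
  have neg: "mixing_chain S K Q ?t (\<lambda>x. 1 - ?f k x)" if "k \<in> {1..N}" for k
    using meas[OF that] range by (intro mixing_chainI[OF K Q sQ assms(12)]) auto
  have "1 \<in> {1..N}" using assms(15) by simp
  \<comment> \<open>The path law and \<open>1 \<le> ?t\<close> do not involve the loss, so one index
    gives access to them.\<close>
  then interpret one: mixing_chain S K Q ?t "?f 1" by (rule pos)
  interpret Q: prob_space Q by (rule Q)
  interpret V: prob_space V unfolding V_def by (rule one.prob_space_validation_law[OF x])
  have spV: "space V = space (PiM {n+1..n+m} (\<lambda>_. S))" by (simp add: V_def validation_law_def)
  have setV: "sets V = sets (PiM {n+1..n+m} (\<lambda>_. S))" by (simp add: V_def validation_law_def)
  have m0: "0 < real m" using assms(17) by simp
  have emp_meas: "(\<lambda>v. emp v (g_hat k)) \<in> borel_measurable V" if "k \<in> {1..N}" for k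
    unfolding emp_def empirical_loss_def measurable_cong_sets[OF setV refl]
    by (intro borel_measurable_divide borel_measurable_sum borel_measurable_const
        measurable_compose[OF _ meas[OF that]] measurable_component_singleton)
  have emp_range: "0 \<le> emp v (g_hat k) \<and> emp v (g_hat k) \<le> 1" for v k
  proof -
    have "(\<Sum>j=n+1..n+m. ?f k (v j)) \<le> (\<Sum>j=n+1..n+m. 1)"
      using range by (intro sum_mono) auto
    then show ?thesis using m0 range
      by (auto simp: emp_def empirical_loss_def intro!: divide_nonneg_nonneg sum_nonneg)
  qed
  have int: "integrable Q (?f k)" if "k \<in> {1..N}" for k
    using range meas[OF that]
    by (intro Q.integrable_const_bound[where B=1]) (auto simp: measurable_cong_sets[OF sQ refl])
  have risk_range: "0 \<le> risk (g_hat k) \<and> risk (g_hat k) \<le> 1" if "k \<in> {1..N}" for k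
    unfolding risk_def expected_loss_def using range int[OF that]
    by (auto intro!: Q.integral_ge_const Q.integral_le_const)
  have mgf_pos: "(\<integral>\<^sup>+v. ennreal (exp (l * (emp v (g_hat k) - risk (g_hat k)))) \<partial>V)
      \<le> ennreal (exp (2 * l * (real ?t / real m) + 9/4 * l\<^sup>2 * (real ?t / real m)))"
    if "k \<in> {1..N}" "0 < l" "?t \<le> m" for k l
    using mixing_chain.validation_deviation[OF pos[OF that(1)] x assms(16) that(2,3)]
    by (simp add: V_def emp_def empirical_loss_def risk_def expected_loss_def)
  have mgf_neg: "(\<integral>\<^sup>+v. ennreal (exp (l * (risk (g_hat k) - emp v (g_hat k)))) \<partial>V)
      \<le> ennreal (exp (2 * l * (real ?t / real m) + 9/4 * l\<^sup>2 * (real ?t / real m)))"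
    if k: "k \<in> {1..N}" and "0 < l" "?t \<le> m" for k l
  proof -
    \<comment> \<open>The constant 1 has mean 1 under \<open>Q\<close> and in the empirical average,
      so it cancels.\<close>
    have "(\<Sum>j=n+1..n+m. 1 - ?f k (v j)) / real m - (\<integral>y. 1 - ?f k y \<partial>Q)
      = risk (g_hat k) - emp v (g_hat k)" for v
      using m0 int[OF k]
      by (simp add: emp_def empirical_loss_def risk_def expected_loss_def sum_subtractf
          Q.prob_space diff_divide_distrib)
    then show ?thesis
      using mixing_chain.validation_deviation[OF neg[OF k] x assms(16) that(2,3)]
      by (simp add: V_def)
  qed
  have k_hat: "k_hat v \<in> {1..N}" if "v \<in> space V" for v
    using assms(22)[of v] that spV by (simp add: is_arg_min_def)
  have k_tilde: "k_tilde \<in> {1..N}" using assms(20) by (simp add: is_arg_min_def)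
  have hat1: "\<bar>risk (g_hat (k_hat v)) - emp v (g_hat (k_hat v))\<bar> \<le> 1" if "v \<in> space V" for v
    using risk_range[OF k_hat[OF that]] emp_range[of v "k_hat v"] by linarith
  have tilde1: "\<bar>emp v (g_hat k_tilde) - risk (g_hat k_tilde)\<bar> \<le> 1" for v
    using risk_range[OF k_tilde] emp_range[of v k_tilde] by linarith
  \<comment> \<open>The selected index is itself the dominating member of the family.\<close>
  have hat0: "\<exists>k\<in>{1..N}. risk (g_hat (k_hat v)) - emp v (g_hat (k_hat v))
      \<le> risk (g_hat k) - emp v (g_hat k)" if "v \<in> space V" for v
    using k_hat[OF that] by blast
  have tilde0: "\<exists>k\<in>{1..N}. emp v (g_hat k_tilde) - risk (g_hat k_tilde)
      \<le> emp v (g_hat k) - risk (g_hat k)" for v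
    using k_tilde by blast
  have D_neg: "(\<lambda>v. risk (g_hat k) - emp v (g_hat k)) \<in> borel_measurable V"
    and D_pos: "(\<lambda>v. emp v (g_hat k) - risk (g_hat k)) \<in> borel_measurable V"
    if "k \<in> {1..N}" for k
    using emp_meas[OF that] by auto
  note hat = V.selected_deviation[OF assms(15) one.t_ge_1 assms(17) _ _ hat0 hat1]
  note tilde = V.selected_deviation[OF assms(15) one.t_ge_1 assms(17) _ _ tilde0 tilde1]
  show ?thesis
    unfolding t_mix_def
    by (intro conjI allI impI; (elim conjE)?)
      (rule hat tilde D_neg D_pos mgf_neg mgf_pos | assumption)+
qed

end
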